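(* Let $\theta$ be a Blaschke product of order $3$ and let $\mathbf{cb}_1,\mathbf{cb}_2,\mathbf{cb}_3$ be a modified Clark basis for $K_{\theta}$, with corresponding points $\eta_1,\eta_2,\eta_3\in\mathbb{T}$. Let $$S = \begin{pmatrix} s_1 & s_4 & s_5 \\ s_4 & s_2 & s_6 \\ s_5 & s_6 & s_3 \end{pmatrix}$$ be a symmetric matrix with complex entries. Then $S$ is the matrix representation of some truncated Toeplitz operator on $K_{\theta}$ with respect to $\mathbf{cb}_1,\mathbf{cb}_2,\mathbf{cb}_3$ if and only if $$s_6 = \frac{1}{ \eta_3 - \eta_2} \left( s_4 \left(\frac{\overline{\eta_{1}}^{\frac{1}{2}}|\theta'(\eta_1)|^{\frac{1}{2}}}{\overline{\eta_{3}}^{\frac{1}{2}}|\theta'(\eta_3)|^{\frac{1}{2}}}\right) ( \eta_1 - \eta_2 ) + s_5 \left(\frac{\overline{\eta_{1}}^{\frac{1}{2}}|\theta'(\eta_1)|^{\frac{1}{2}}}{\overline{\eta_{2}}^{\frac{1}{2}}|\theta'(\eta_2)|^{\frac{1}{2}}}\right)(\eta_3 - \eta_1 ) \right),$$ where $\overline{\eta_{j}}^{\frac{1}{2}}$ is the square root defined by: if $\gamma=\arg( \overline{\eta_j}) \in [0, 2 \pi)$, then $\arg( \overline{\eta_j}^{\frac{1}{2}}) = \frac{\gamma}{2} \in [0, \pi)$.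
   Context: $\mathbb{D}$ is the open unit disc in $\mathbb{C}$ and $\mathbb{T}$ the unit circle. $H^2$ is the Hardy space of the disc, viewed via radial boundary values as a closed subspace of $L^2(\mathbb{T})$ (normalized Lebesgue measure; inner product linear in the first variable). A finite Blaschke product $\theta$ has order $n$ if it has $n$ zeros in $\mathbb{D}$ counted with multiplicity. The model space is $K_\theta = H^2 \ominus \theta H^2$; for $\theta$ a finite Blaschke product of order $n$ it has dimension $n$ and every $f\in K_\theta$ has a well-defined value at every point of $\mathbb{T}$. For $\zeta\in\mathbb{D}\cup\mathbb{T}$ the reproducing kernel is $k_\zeta(z)=\frac{1-\overline{\theta(\zeta)}\theta(z)}{1-\overline{\zeta}z}\in K_\theta$. Modified Clark basis: let $\theta$ be a finite Blaschke product of order $n$. For parameters $t\in\mathbb{D}$ and $\alpha\in\mathbb{T}$ put $w=\frac{\alpha+\theta(t)}{1+\overline{\theta(t)}\alpha}\in\mathbb{T}$. There are exactly $n$ distinct points $\eta_1,\dots,\eta_n$ with $\theta(\eta_i)=w$, all lying on $\mathbb{T}$. The corresponding modified Clark basis is the orthonormal basis of $K_\theta$ $$\mathbf{cb}_i(z)=\left(\overline{\eta_i}\,w\right)^{\frac12}\frac{k_{\eta_i}(z)}{\|k_{\eta_i}\|},\qquad i=1,\dots,n,$$ where the square root is the unimodular number with argument $\frac{\delta_1+\delta_2}{2}$, $\delta_1=\arg(\overline{\eta_i})\in[0,2\pi)$, $\delta_2=\arg(w)\in[0,2\pi)$. A modified Clark basis is any basis arising in this way for some $t\in\mathbb{D}$,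 $\alpha\in\mathbb{T}$; the points $\eta_i$ are its corresponding points. A truncated Toeplitz operator (TTO) on $K_\theta$ is an operator of the form $A_\phi f = P_\theta(\phi f)$, $f \in K_\theta$, for some $\phi\in L^\infty(\mathbb{T})$, where $P_\theta: L^2(\mathbb{T})\to K_\theta$ is the orthogonal projection. The matrix representation of an operator $A$ with respect to an orthonormal basis $v_1,\dots,v_n$ has $(i,j)$ entry $\langle A v_j, v_i\rangle$. *)

theory Defs
  imports "HOL-Analysis.Analysis"
begin

text \<open>
  A finite Blaschke product is taken as a rational function on the whole plane, so that its
  values and derivative on the unit circle are the usual ones. (At the poles, which lie outside
  the closed disc, Isabelle's division assigns the value 0; this is irrelevant here.)
\<close>

definition finite_blaschke_product :: "nat \<Rightarrow> (complex \<Rightarrow> complex) \<Rightarrow> bool" where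
  "finite_blaschke_product n \<theta> \<longleftrightarrow>
     (\<exists>c a. cmod c = 1 \<and> (\<forall>i<n. cmod (a i) < 1) \<and>
        \<theta> = (\<lambda>z. c * (\<Prod>i<n. (z - a i) / (1 - cnj (a i) * z))))"

definition circle_measure :: "complex measure" where
  "circle_measure =
     distr (uniform_measure lborel {0..<2 * pi}) (restrict_space borel (sphere 0 1)) cis"

text \<open>
  Elements of $L^2$ of the circle are represented by functions, two of which stand for the same
  element iff they agree almost everywhere. Only the values on the unit circle, which is the
  space of the measure, play a role.
\<close>

definition L2_circle :: "(complex \<Rightarrow> complex) set" where
  "L2_circle = {f \<in> borel_measurable circle_measure.
     integrable circle_measure (\<lambda>z. (cmod (f z))\<^sup>2)}"

definition Linf_circle :: "(complex \<Rightarrow> complex) set" where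
  "Linf_circle = {f \<in> borel_measurable circle_measure.
     \<exists>C. AE z in circle_measure. cmod (f z) \<le> C}"

definition L2_inner :: "(complex \<Rightarrow> complex) \<Rightarrow> (complex \<Rightarrow> complex) \<Rightarrow> complex" where
  "L2_inner f g = (\<integral>z. f z * cnj (g z) \<partial>circle_measure)"

definition L2_norm :: "(complex \<Rightarrow> complex) \<Rightarrow> real" where
  "L2_norm f = sqrt (\<integral>z. (cmod (f z))\<^sup>2 \<partial>circle_measure)"

text \<open>The Hardy space, as the set of radial boundary functions in $L^2$ of the circle.\<close>

definition hardy2 :: "(complex \<Rightarrow> complex) set" where
  "hardy2 = {f \<in> L2_circle. \<exists>F. F holomorphic_on ball 0 1 \<and>
     bdd_above ((\<lambda>r. \<integral>z. (cmod (F (complex_of_real r * z)))\<^sup>2 \<partial>circle_measure) ` {0..<1}) \<and>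
     (AE z in circle_measure. ((\<lambda>r. F (complex_of_real r * z)) \<longlongrightarrow> f z) (at_left 1))}"

definition model_space :: "(complex \<Rightarrow> complex) \<Rightarrow> (complex \<Rightarrow> complex) set" where
  "model_space \<theta> = {f \<in> hardy2. \<forall>h \<in> hardy2. L2_inner f (\<lambda>z. \<theta> z * h z) = 0}"

text \<open>
  The orthogonal projection of $L^2$ onto the model space. The element is unique only up to
  equality almost everywhere; the choice operator picks a representative.
\<close>

definition model_proj ::
    "(complex \<Rightarrow> complex) \<Rightarrow> (complex \<Rightarrow> complex) \<Rightarrow> complex \<Rightarrow> complex" where
  "model_proj \<theta> f =
     (SOME g. g \<in> model_space \<theta> \<and> (\<forall>h \<in> model_space \<theta>. L2_inner (\<lambda>z. f z - g z) h = 0))"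

text \<open>
  The symbol of an operator is in $L^\infty$; the equation $A f = P_\theta(\phi f)$ is one between
  elements of the model space, that is, an equality almost everywhere. Membership of \<open>A f\<close> in the
  model space is not redundant: it keeps the chosen representative measurable.
\<close>

definition truncated_toeplitz ::
    "(complex \<Rightarrow> complex) \<Rightarrow> ((complex \<Rightarrow> complex) \<Rightarrow> complex \<Rightarrow> complex) \<Rightarrow> bool" where
  "truncated_toeplitz \<theta> A \<longleftrightarrow>
     (\<exists>\<phi> \<in> Linf_circle. \<forall>f \<in> model_space \<theta>.
        A f \<in> model_space \<theta> \<and>
        (AE z in circle_measure. A f z = model_proj \<theta> (\<lambda>z. \<phi> z * f z) z))"

definition matrix_rep ::
    "('n::finite \<Rightarrow> complex \<Rightarrow> complex) \<Rightarrow> ((complex \<Rightarrow> complex) \<Rightarrow> complex \<Rightarrow> complex)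
      \<Rightarrow> complex ^ 'n ^ 'n" where
  "matrix_rep v A = (\<chi> i j. L2_inner (A (v j)) (v i))"

text \<open>
  For \<open>\<zeta>\<close> on the unit circle, the quotient has a removable singularity at \<open>z = \<zeta>\<close>, where
  Isabelle's division gives 0 instead of the limit. This changes the function on a null set only.
\<close>

definition model_kernel ::
    "(complex \<Rightarrow> complex) \<Rightarrow> complex \<Rightarrow> complex \<Rightarrow> complex" where
  "model_kernel \<theta> \<zeta> z = (1 - cnj (\<theta> \<zeta>) * \<theta> z) / (1 - cnj \<zeta> * z)"

definition clark_value :: "(complex \<Rightarrow> complex) \<Rightarrow> complex \<Rightarrow> complex \<Rightarrow> complex" where
  "clark_value \<theta> t \<alpha> = (\<alpha> + \<theta> t) / (1 + cnj (\<theta> t) * \<alpha>)"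

text \<open>
  The index type \<open>'n\<close> has as many elements as the order of \<open>\<theta>\<close>; the points \<open>\<eta> i\<close> enumerate,
  without repetition and in any order, all solutions of \<open>\<theta> \<zeta> = w\<close>.
\<close>

definition modified_clark_basis ::
    "(complex \<Rightarrow> complex) \<Rightarrow> ('n::finite \<Rightarrow> complex) \<Rightarrow> ('n \<Rightarrow> complex \<Rightarrow> complex) \<Rightarrow> bool" where
  "modified_clark_basis \<theta> \<eta> cb \<longleftrightarrow>
     (\<exists>t \<alpha> w. cmod t < 1 \<and> cmod \<alpha> = 1 \<and> w = clark_value \<theta> t \<alpha> \<and>
        bij_betw \<eta> UNIV {\<zeta> \<in> sphere 0 1. \<theta> \<zeta> = w} \<and>
        cb = (\<lambda>i z. cis ((Arg2pi (cnj (\<eta> i)) + Arg2pi w) / 2) *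
                (model_kernel \<theta> (\<eta> i) z / complex_of_real (L2_norm (model_kernel \<theta> (\<eta> i))))))"

text \<open>The square root with argument in $[0,\pi)$ of a unimodular number.\<close>

definition unimodular_sqrt :: "complex \<Rightarrow> complex" where
  "unimodular_sqrt z = cis (Arg2pi z / 2)"

end

theory Submission
  imports Defs "HOL-Complex_Analysis.Complex_Analysis"
begin

text \<open>
  Let \<open>\<theta>\<close> be a finite Blaschke product and let \<open>\<eta>\<^sub>i\<close> be the solutions of \<open>\<theta> \<zeta> = w\<close> on the circle.
  The boundary values of the modified Clark functions \<open>v\<^sub>i\<close> are, up to a null set,

    \<open>v\<^sub>i z = \<sigma> * d\<^sub>i * (\<theta> z - w) / (z - \<eta>\<^sub>i)\<close>,

  where \<open>\<sigma>\<close> does not depend on \<open>i\<close> and \<open>1 / d\<^sub>i\<close> is the square root of the conjugate of \<open>\<eta>\<^sub>i\<close>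
  times the square root of \<open>\<bar>\<theta>' \<eta>\<^sub>i\<bar>\<close>. The square roots are chosen in such a way that
  conjugation only replaces \<open>\<sigma>\<close> by another function of \<open>z\<close>, and keeps \<open>d\<^sub>i / (z - \<eta>\<^sub>i)\<close>
  (\<open>clark_eq\<close>). Hence there is one function \<open>Z\<close> with

    \<open>v\<^sub>j z * cnj (v\<^sub>i z) = Z z * d\<^sub>i * d\<^sub>j / ((z - \<eta>\<^sub>i) * (z - \<eta>\<^sub>j))\<close>

  for all \<open>i\<close> and \<open>j\<close> (\<open>clark_product\<close>). Since \<open>v\<^sub>i\<close> lies in the model space, the entry \<open>(i, j)\<close>
  of the matrix of the operator with symbol \<open>\<phi>\<close> is the integral of \<open>\<phi> * v\<^sub>j * cnj v\<^sub>i\<close>. Therefore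
  the matrices that occur are governed by the linear relations between the rational functions
  \<open>1 / ((z - \<eta>\<^sub>i) * (z - \<eta>\<^sub>j))\<close>.

  The symmetry in \<open>i\<close> and \<open>j\<close> makes the matrix symmetric. The partial fraction
  \<open>(\<eta>\<^sub>j - \<eta>\<^sub>i) / ((z - \<eta>\<^sub>i) * (z - \<eta>\<^sub>j)) = 1 / (z - \<eta>\<^sub>j) - 1 / (z - \<eta>\<^sub>i)\<close> telescopes around the
  triangle \<open>1, 2, 3\<close> and gives one relation between the entries (1,2), (1,3) and (2,3)
  (\<open>clark_three_term_AE\<close>); divided by \<open>d\<^sub>1\<close> and \<open>\<eta>\<^sub>3 - \<eta>\<^sub>2\<close>, it is the stated formula for \<open>s\<^sub>6\<close>.
  Conversely, the three diagonal products and the products for (1,2) and (1,3) are linearly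
  independent (\<open>clark_products_independent\<close>). Their Gram matrix is then invertible, and so a
  combination of their conjugates is a bounded symbol for which these five entries have
  prescribed values (\<open>Linf_dual_exists\<close>). The relation settles the remaining entry.

  Two facts about the model space support this. First, the orthogonal projection onto it exists.
  This follows from the explicit Takenaka functions \<open>e\<^sub>j\<close>, which lie in the model space and satisfy
  \<open>(\<Sum>j. cnj (e\<^sub>j \<zeta>) * e\<^sub>j z) * (1 - cnj \<zeta> * z) = 1 - cnj (\<theta> \<zeta>) * \<theta> z\<close> by a telescoping
  sum. The left factor is thus the reproducing kernel, so every \<open>h\<close> in the model space is the sum of
  \<open>L2_inner h e\<^sub>j * e\<^sub>j\<close> (\<open>model_space_expansion\<close>), which is enough to project. The reproducing
  property comes from Cauchy's formula on smaller circles (\<open>hardy_pairing\<close>). Second, the same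
  sum is continuous up to the boundary, whence the squared norm of the kernel at \<open>\<eta>\<^sub>i\<close>
  is its value at \<open>\<eta>\<^sub>i\<close>, which is \<open>\<bar>\<theta>' \<eta>\<^sub>i\<bar>\<close>.
\<close>

section \<open>The unit circle and its normalized arc length\<close>

lemma unimodular_sqrt_square:
  assumes "cmod z = 1"
  shows "unimodular_sqrt z * unimodular_sqrt z = z"
proof -
  have "unimodular_sqrt z * unimodular_sqrt z = cis (Arg2pi z)"
    by (simp add: unimodular_sqrt_def cis_mult)
  also have "\<dots> = z"
    by (metis Arg2pi_eq assms cis_conv_exp mult_1 of_real_1)
  finally show ?thesis .
qed

lemma cmod_unimodular_sqrt [simp]: "cmod (unimodular_sqrt z) = 1"
  by (simp add: unimodular_sqrt_def)

lemma unimodular_cnj_mult: "cmod z = 1 \<Longrightarrow> z * cnj z = 1"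
  using complex_norm_square[of z] by simp

lemma space_circle_measure [simp]: "space circle_measure = sphere 0 1"
  by (simp add: circle_measure_def space_restrict_space)

lemma sets_circle_measure [measurable_cong]:
  "sets circle_measure = sets (restrict_space borel (sphere 0 1))"
  by (simp add: circle_measure_def)

lemma borel_measurable_circle [measurable (raw)]:
  "f \<in> borel_measurable borel \<Longrightarrow> f \<in> borel_measurable circle_measure"
  by (simp add: measurable_cong_sets [OF sets_circle_measure refl] measurable_restrict_space1)

lemma measurable_cis_circle [measurable]:
  "cis \<in> measurable (uniform_measure lborel {0..<2 * pi}) (restrict_space borel (sphere 0 1))"
proof -
  have [measurable]: "cis \<in> borel_measurable borel"
    by (intro borel_measurable_continuous_onI continuous_intros)
  have "cis \<in> measurable borel (restrict_space borel (sphere 0 1))"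
    by (intro measurable_restrict_space2) auto
  then show ?thesis
    by (simp cong: measurable_cong_sets)
qed

lemma finite_measure_circle: "finite_measure circle_measure"
proof
  have "emeasure circle_measure (space circle_measure) = 1"
    unfolding circle_measure_def
    by (subst emeasure_distr) (auto simp: space_restrict_space sets_restrict_space
        emeasure_uniform_measure_1 vimage_def)
  then show "emeasure circle_measure (space circle_measure) \<noteq> \<infinity>"
    by simp
qed

interpretation circle: finite_measure circle_measure
  by (rule finite_measure_circle)

lemma integral_circle_measure:
  fixes f :: "complex \<Rightarrow> complex"
  assumes f: "f \<in> borel_measurable circle_measure"
  shows "(\<integral>z. f z \<partial>circle_measure) = (\<integral>t. indicator {0..<2 * pi} t *\<^sub>R f (cis t) \<partial>lborel) / (2 * pi)"
proof -
  have um: "uniform_measure lborel {0..<2 * pi} =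
      density lborel (\<lambda>t. ennreal (indicator {0..<2 * pi} t / (2 * pi)))"
    unfolding uniform_measure_def
    by (intro density_cong)
       (auto simp: indicator_def divide_ennreal ennreal_1[symmetric] simp del: ennreal_1)
  have f': "f \<in> borel_measurable (restrict_space borel (sphere 0 1))"
    using f by (simp cong: measurable_cong_sets add: sets_circle_measure)
  have "(\<lambda>t. f (cis t)) \<in> borel_measurable (uniform_measure lborel {0..<2 * pi})"
    using measurable_compose[OF measurable_cis_circle f'] .
  then have fc: "(\<lambda>t. f (cis t)) \<in> borel_measurable lborel"
    by (simp cong: measurable_cong_sets)
  have "(\<integral>z. f z \<partial>circle_measure) = (\<integral>t. f (cis t) \<partial>uniform_measure lborel {0..<2 * pi})"
    unfolding circle_measure_def by (rule integral_distr[OF measurable_cis_circle f'])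
  also have "\<dots> = (\<integral>t. (indicator {0..<2 * pi} t / (2 * pi)) *\<^sub>R f (cis t) \<partial>lborel)"
    unfolding um by (rule integral_density) (use fc in auto)
  also have "\<dots> = (\<integral>t. (indicator {0..<2 * pi} t *\<^sub>R f (cis t)) / (2 * pi) \<partial>lborel)"
    by (intro Bochner_Integration.integral_cong) (auto simp: scaleR_conv_of_real)
  finally show ?thesis
    by simp
qed

lemma borel_measurable_circle_continuous:
  fixes f :: "complex \<Rightarrow> 'a::real_normed_vector"
  assumes "continuous_on (sphere 0 1) f"
  shows "f \<in> borel_measurable circle_measure"
  using borel_measurable_continuous_on_restrict[OF assms]
  by (simp cong: measurable_cong_sets add: sets_circle_measure)

lemma circle_integral_continuous:
  fixes f :: "complex \<Rightarrow> complex"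
  assumes f: "continuous_on (sphere 0 1) f"
  shows "(\<integral>z. f z \<partial>circle_measure) = integral {0..2 * pi} (\<lambda>t. f (cis t)) / (2 * pi)"
proof -
  have c: "continuous_on {0..2 * pi} (\<lambda>t. f (cis t))"
    by (rule continuous_on_compose2[OF f]) (auto intro!: continuous_intros)
  have "(\<integral>t. indicator {0..<2 * pi} t *\<^sub>R f (cis t) \<partial>lborel) =
        (\<integral>t. indicator {0..2 * pi} t *\<^sub>R f (cis t) \<partial>lborel)"
  proof (rule integral_cong_AE)
    show "(\<lambda>t. indicator {0..2 * pi} t *\<^sub>R f (cis t)) \<in> borel_measurable lborel"
      using borel_measurable_continuous_on_indicator[OF _ c] by simp
    have "(\<lambda>t. indicator {0..<2 * pi} t *\<^sub>R (indicator {0..2 * pi} t *\<^sub>R f (cis t))) \<in> borel_measurable lborel"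
      using borel_measurable_continuous_on_indicator[OF _ c] by measurable
    also have "(\<lambda>t. indicator {0..<2 * pi} t *\<^sub>R (indicator {0..2 * pi} t *\<^sub>R f (cis t))) =
        (\<lambda>t. indicator {0..<2 * pi} t *\<^sub>R f (cis t))"
      by (auto simp: indicator_def)
    finally show "(\<lambda>t. indicator {0..<2 * pi} t *\<^sub>R f (cis t)) \<in> borel_measurable lborel" .
    show "AE t in lborel. indicator {0..<2 * pi} t *\<^sub>R f (cis t) = indicator {0..2 * pi} t *\<^sub>R f (cis t)"
      using AE_lborel_singleton[of "2 * pi"] by eventually_elim (auto simp: indicator_def)
  qed
  also have "\<dots> = integral {0..2 * pi} (\<lambda>t. f (cis t))"
    using set_borel_integral_eq_integral(2)[OF borel_integrable_atLeastAtMost'[OF c]]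
    by (simp add: set_lebesgue_integral_def)
  finally show ?thesis
    using integral_circle_measure[OF borel_measurable_circle_continuous[OF f]] by simp
qed

text \<open>
  The set of angles in the open interval where the function does not vanish is open and null,
  hence empty; the missing angle is a limit of the others.
\<close>

lemma AE_circle_imp_sphere:
  fixes p :: "complex \<Rightarrow> complex"
  assumes ae: "AE z in circle_measure. p z = 0" and p: "continuous_on (sphere 0 1) p"
    and z: "z \<in> sphere 0 1"
  shows "p z = 0"
proof -
  have c: "continuous_on UNIV (\<lambda>t. p (cis t))"
    by (rule continuous_on_compose2[OF p]) (auto intro!: continuous_intros)
  have "AE t in uniform_measure lborel {0..<2 * pi}. p (cis t) = 0"
    using AE_distrD[OF measurable_cis_circle] ae unfolding circle_measure_def by blast
  then have "AE t in lborel. t \<in> {0..<2 * pi} \<longrightarrow> p (cis t) = 0"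
    by (subst (asm) AE_uniform_measure) auto
  then have "AE t in lborel. t \<notin> {t \<in> {0<..<2 * pi}. p (cis t) \<noteq> 0}"
    by eventually_elim auto
  moreover have op: "open {t \<in> {0<..<2 * pi}. p (cis t) \<noteq> 0}"
  proof -
    have "open ({0<..<2 * pi} \<inter> (\<lambda>t. p (cis t)) -` (- {0}))"
      by (intro continuous_open_preimage continuous_on_subset[OF c]) auto
    also have "\<dots> = {t \<in> {0<..<2 * pi}. p (cis t) \<noteq> 0}"
      by auto
    finally show ?thesis .
  qed
  ultimately have "{t \<in> {0<..<2 * pi}. p (cis t) \<noteq> 0} \<in> null_sets lborel"
    by (subst AE_iff_null_sets) auto
  then have "negligible {t \<in> {0<..<2 * pi}. p (cis t) \<noteq> 0}"
    by (metis negligible_iff_null_sets null_sets_completionI)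
  then have "{t \<in> {0<..<2 * pi}. p (cis t) \<noteq> 0} = {}"
    using open_not_negligible[OF op] by blast
  then have *: "p (cis t) = 0" if "t \<in> {0<..<2 * pi}" for t
    using that by auto
  have **: "p (cis t) = 0" if "t \<in> {0..2 * pi}" for t
    by (rule continuous_constant_on_closure[of "{0<..<2 * pi}" "\<lambda>t. p (cis t)"])
       (use that * in \<open>auto intro: continuous_on_subset[OF c]\<close>)
  have "z = cis (Arg2pi z)"
    using Arg2pi_eq[of z] z by (simp add: cis_conv_exp)
  moreover have "Arg2pi z \<in> {0..2 * pi}"
    using Arg2pi[of z] by (auto simp: less_imp_le)
  ultimately show ?thesis
    using ** by metis
qed

lemma AE_circle_not_in_finite:
  assumes "finite F"
  shows "AE z in circle_measure. z \<notin> F"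
proof -
  have "AE z in circle_measure. z \<noteq> \<zeta>" for \<zeta>
  proof -
    have "AE t in lborel. t \<in> {0..<2 * pi} \<longrightarrow> cis t \<noteq> \<zeta>"
      using AE_lborel_singleton[of "Arg2pi \<zeta>"]
    proof eventually_elim
      case (elim t)
      then show ?case
        using Arg2pi_unique[of 1 t \<zeta>] by (auto simp: cis_conv_exp)
    qed
    then have "AE t in uniform_measure lborel {0..<2 * pi}. cis t \<noteq> \<zeta>"
      by (intro AE_uniform_measureI) auto
    moreover have "{z \<in> sphere 0 1. z \<noteq> \<zeta>} \<in> sets (restrict_space borel (sphere 0 1))"
      by (auto simp: sets_restrict_space intro!: image_eqI[of _ _ "- {\<zeta>}"])
    ultimately show ?thesis
      unfolding circle_measure_def
      by (subst AE_distr_iff[OF measurable_cis_circle]) (auto simp: space_restrict_space)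
  qed
  then have "AE z in circle_measure. \<forall>\<zeta>\<in>F. z \<noteq> \<zeta>"
    by (intro AE_finite_allI assms)
  then show ?thesis
    by eventually_elim auto
qed

section \<open>Square-integrable and bounded functions on the circle\<close>

lemma borel_measurable_cnj [measurable (raw)]:
  "f \<in> borel_measurable M \<Longrightarrow> (\<lambda>x. cnj (f x)) \<in> borel_measurable M"
  by (rule borel_measurable_continuous_on) (auto intro!: continuous_intros)

lemma L2_circle_mult_integrable:
  assumes "f \<in> L2_circle" "g \<in> L2_circle"
  shows "integrable circle_measure (\<lambda>z. f z * g z)"
proof (rule Bochner_Integration.integrable_bound)
  show "integrable circle_measure (\<lambda>z. (cmod (f z))\<^sup>2 + (cmod (g z))\<^sup>2)"
    using assms by (auto simp: L2_circle_def)
  show "(\<lambda>z. f z * g z) \<in> borel_measurable circle_measure"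
    using assms by (auto simp: L2_circle_def)
  show "AE z in circle_measure. norm (f z * g z) \<le> norm ((cmod (f z))\<^sup>2 + (cmod (g z))\<^sup>2)"
  proof (intro AE_I2)
    fix z
    have "2 * (cmod (f z) * cmod (g z)) \<le> (cmod (f z))\<^sup>2 + (cmod (g z))\<^sup>2"
      using sum_squares_bound[of "cmod (f z)" "cmod (g z)"] by simp
    moreover have "0 \<le> cmod (f z) * cmod (g z)"
      by simp
    ultimately have "cmod (f z) * cmod (g z) \<le> (cmod (f z))\<^sup>2 + (cmod (g z))\<^sup>2"
      by linarith
    then show "norm (f z * g z) \<le> norm ((cmod (f z))\<^sup>2 + (cmod (g z))\<^sup>2)"
      by (simp add: norm_mult)
  qed
qed

lemma L2_circle_measurable [measurable_dest]:
  "f \<in> L2_circle \<Longrightarrow> f \<in> borel_measurable circle_measure"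
  by (simp add: L2_circle_def)

lemma L2_circle_cnj:
  assumes "f \<in> L2_circle"
  shows "(\<lambda>z. cnj (f z)) \<in> L2_circle"
  using assms by (auto simp: L2_circle_def intro!: borel_measurable_cnj)

lemma L2_inner_integrable:
  assumes "f \<in> L2_circle" "g \<in> L2_circle"
  shows "integrable circle_measure (\<lambda>z. f z * cnj (g z))"
  using L2_circle_mult_integrable[OF assms(1) L2_circle_cnj[OF assms(2)]] .

lemma L2_circle_Linf_mult:
  assumes "\<phi> \<in> Linf_circle" "f \<in> L2_circle"
  shows "(\<lambda>z. \<phi> z * f z) \<in> L2_circle"
proof -
  from assms(1) obtain C where C: "AE z in circle_measure. cmod (\<phi> z) \<le> C"
    and [measurable]: "\<phi> \<in> borel_measurable circle_measure"
    by (auto simp: Linf_circle_def)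
  have [measurable]: "f \<in> borel_measurable circle_measure"
    using assms(2) by (rule L2_circle_measurable)
  have "integrable circle_measure (\<lambda>z. (cmod (\<phi> z * f z))\<^sup>2)"
  proof (rule Bochner_Integration.integrable_bound)
    show "integrable circle_measure (\<lambda>z. C\<^sup>2 * (cmod (f z))\<^sup>2)"
      using assms(2) by (auto simp: L2_circle_def)
    show "AE z in circle_measure. norm ((cmod (\<phi> z * f z))\<^sup>2) \<le> norm (C\<^sup>2 * (cmod (f z))\<^sup>2)"
      using C
    proof eventually_elim
      case (elim z)
      then have "(cmod (\<phi> z))\<^sup>2 \<le> C\<^sup>2"
        by (intro power_mono) auto
      then show ?case
        by (simp add: norm_mult power_mult_distrib mult_right_mono)
    qed
  qed measurable
  then show ?thesis
    by (simp add: L2_circle_def)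
qed

lemma const_L2_circle: "(\<lambda>z. c) \<in> L2_circle"
  by (simp add: L2_circle_def)

lemma Linf_circle_imp_L2_circle: "f \<in> Linf_circle \<Longrightarrow> f \<in> L2_circle"
  using L2_circle_Linf_mult[OF _ const_L2_circle[of 1]] by simp

lemma Linf_circle_mult:
  assumes "f \<in> Linf_circle" "g \<in> Linf_circle"
  shows "(\<lambda>z. f z * g z) \<in> Linf_circle"
proof -
  obtain B C where "AE z in circle_measure. cmod (f z) \<le> B" "AE z in circle_measure. cmod (g z) \<le> C"
    using assms by (auto simp: Linf_circle_def)
  then have "AE z in circle_measure. cmod (f z * g z) \<le> B * C"
  proof eventually_elim
    case (elim z)
    then show ?case
      using order_trans[OF norm_ge_zero elim(1)] by (simp add: norm_mult mult_mono)
  qed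
  then show ?thesis
    using assms by (auto simp: Linf_circle_def)
qed

lemma Linf_circle_sum_cnj:
  assumes "finite I" "\<And>i. i \<in> I \<Longrightarrow> f i \<in> Linf_circle"
  shows "(\<lambda>z. \<Sum>i\<in>I. x i * cnj (f i z)) \<in> Linf_circle"
proof -
  have "\<forall>i. \<exists>C. i \<in> I \<longrightarrow> (AE z in circle_measure. cmod (f i z) \<le> C)"
    using assms(2) by (auto simp: Linf_circle_def)
  then obtain C where C: "\<And>i. i \<in> I \<Longrightarrow> AE z in circle_measure. cmod (f i z) \<le> C i"
    by metis
  then have "AE z in circle_measure. \<forall>i\<in>I. cmod (f i z) \<le> C i"
    by (intro AE_finite_allI assms(1))
  then have "AE z in circle_measure. cmod (\<Sum>i\<in>I. x i * cnj (f i z)) \<le> (\<Sum>i\<in>I. cmod (x i) * C i)"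
    by eventually_elim (auto intro!: sum_norm_le mult_left_mono simp: norm_mult)
  moreover have "(\<lambda>z. \<Sum>i\<in>I. x i * cnj (f i z)) \<in> borel_measurable circle_measure"
    using assms(2) by (intro borel_measurable_sum borel_measurable_times borel_measurable_cnj)
      (auto simp: Linf_circle_def)
  ultimately show ?thesis
    by (auto simp: Linf_circle_def)
qed

lemma L2_inner_commute: "L2_inner f g = cnj (L2_inner g f)"
  unfolding L2_inner_def by (simp add: mult.commute flip: Bochner_Integration.integral_cnj)

lemma L2_inner_sum_left:
  assumes "finite I" "\<And>i. i \<in> I \<Longrightarrow> f i \<in> L2_circle" "g \<in> L2_circle"
  shows "L2_inner (\<lambda>z. \<Sum>i\<in>I. c i * f i z) g = (\<Sum>i\<in>I. c i * L2_inner (f i) g)"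
proof -
  have "L2_inner (\<lambda>z. \<Sum>i\<in>I. c i * f i z) g =
      (\<integral>z. (\<Sum>i\<in>I. c i * (f i z * cnj (g z))) \<partial>circle_measure)"
    unfolding L2_inner_def by (simp add: sum_distrib_right mult.assoc)
  also have "\<dots> = (\<Sum>i\<in>I. \<integral>z. c i * (f i z * cnj (g z)) \<partial>circle_measure)"
    using assms by (intro Bochner_Integration.integral_sum integrable_mult_right L2_inner_integrable)
  finally show ?thesis
    by (simp add: L2_inner_def)
qed

lemma L2_inner_sum_right:
  assumes "finite I" "\<And>i. i \<in> I \<Longrightarrow> f i \<in> L2_circle" "g \<in> L2_circle"
  shows "L2_inner g (\<lambda>z. \<Sum>i\<in>I. c i * f i z) = (\<Sum>i\<in>I. cnj (c i) * L2_inner g (f i))"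
  by (subst (1 2) L2_inner_commute) (simp add: L2_inner_sum_left[OF assms])

lemma L2_inner_diff_left:
  assumes "f \<in> L2_circle" "g \<in> L2_circle" "h \<in> L2_circle"
  shows "L2_inner (\<lambda>z. f z - g z) h = L2_inner f h - L2_inner g h"
  unfolding L2_inner_def left_diff_distrib
  using assms by (intro Bochner_Integration.integral_diff L2_inner_integrable)

lemma L2_inner_cong_AE:
  assumes "f \<in> borel_measurable circle_measure" "f' \<in> borel_measurable circle_measure"
    "g \<in> borel_measurable circle_measure" "g' \<in> borel_measurable circle_measure"
    "AE z in circle_measure. f z = f' z" "AE z in circle_measure. g z = g' z"
  shows "L2_inner f g = L2_inner f' g'"
  unfolding L2_inner_def
proof (rule integral_cong_AE)
  show "AE z in circle_measure. f z * cnj (g z) = f' z * cnj (g' z)"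
    using assms(5,6) by eventually_elim auto
qed (use assms in \<open>auto intro!: borel_measurable_times borel_measurable_cnj\<close>)

section \<open>Bounded symbols with prescribed integrals\<close>

text \<open>
  The symbol is sought as a combination of the conjugates of the given functions, which turns
  the conditions into a linear system with their Gram matrix. A vector in the kernel of that matrix
  gives a combination of norm 0, so independence makes the matrix invertible.
\<close>

lemma Linf_dual_exists:
  fixes f :: "'k::finite \<Rightarrow> complex \<Rightarrow> complex"
  assumes f: "\<And>k. f k \<in> Linf_circle"
    and indep: "\<And>x k. AE z in circle_measure. (\<Sum>k\<in>UNIV. x k * f k z) = 0 \<Longrightarrow> x k = 0"
  shows "\<exists>\<phi>\<in>Linf_circle. \<forall>k. (\<integral>z. \<phi> z * f k z \<partial>circle_measure) = b k"
proof -
  define \<phi> where "\<phi> x z = (\<Sum>l\<in>UNIV. x $ l * cnj (f l z))" for x :: "complex ^ 'k" and z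
  define G :: "complex ^ 'k ^ 'k" where
    "G = (\<chi> k l. \<integral>z. cnj (f l z) * f k z \<partial>circle_measure)"
  have \<phi>: "\<phi> x \<in> Linf_circle" for x
    unfolding \<phi>_def by (intro Linf_circle_sum_cnj f) auto
  have f2: "f k \<in> L2_circle" for k
    by (intro Linf_circle_imp_L2_circle f)
  have G: "(\<integral>z. \<phi> x z * f k z \<partial>circle_measure) = (G *v x) $ k" for x k
  proof -
    have "(\<integral>z. \<phi> x z * f k z \<partial>circle_measure) =
        (\<integral>z. (\<Sum>l\<in>UNIV. x $ l * (cnj (f l z) * f k z)) \<partial>circle_measure)"
      by (simp add: \<phi>_def sum_distrib_right mult.assoc)
    also have "\<dots> = (\<Sum>l\<in>UNIV. \<integral>z. x $ l * (cnj (f l z) * f k z) \<partial>circle_measure)"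
      by (intro Bochner_Integration.integral_sum integrable_mult_right
          L2_circle_mult_integrable L2_circle_cnj f2)
    finally show ?thesis
      by (simp add: G_def matrix_vector_mult_def mult.commute)
  qed
  have "x = 0" if x: "G *v x = 0" for x
  proof -
    have "L2_inner (\<phi> x) (\<lambda>z. \<Sum>k\<in>UNIV. x $ k * cnj (f k z)) =
        (\<Sum>k\<in>UNIV. cnj (x $ k) * L2_inner (\<phi> x) (\<lambda>z. cnj (f k z)))"
      by (intro L2_inner_sum_right L2_circle_cnj f2 Linf_circle_imp_L2_circle \<phi>) auto
    also have "\<dots> = 0"
      using G[of x] x by (simp add: L2_inner_def)
    finally have "L2_inner (\<phi> x) (\<phi> x) = 0"
      by (simp add: \<phi>_def[abs_def])
    then have "(\<integral>z. (cmod (\<phi> x z))\<^sup>2 \<partial>circle_measure) = 0"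
      unfolding L2_inner_def complex_norm_square[symmetric]
      by (simp del: of_real_power)
    then have "AE z in circle_measure. (cmod (\<phi> x z))\<^sup>2 = 0"
      using Linf_circle_imp_L2_circle[OF \<phi>, of x]
      by (subst (asm) integral_nonneg_eq_0_iff_AE) (auto simp: L2_circle_def)
    then have "AE z in circle_measure. (\<Sum>k\<in>UNIV. cnj (x $ k) * f k z) = 0"
    proof eventually_elim
      case (elim z)
      then have "cnj (\<phi> x z) = 0"
        by simp
      then show ?case
        by (simp add: \<phi>_def)
    qed
    then have "cnj (x $ k) = 0" for k
      by (rule indep)
    then show "x = 0"
      by (simp add: vec_eq_iff)
  qed
  then obtain B where "B ** G = mat 1"
    using matrix_left_invertible_ker[of G] by blast
  then have "G ** B = mat 1"
    by (simp add: matrix_left_right_inverse)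
  then have "G *v (B *v (\<chi> k. b k)) = (\<chi> k. b k)"
    by (simp add: matrix_vector_mul_assoc)
  then have "(\<integral>z. \<phi> (B *v (\<chi> k. b k)) z * f k z \<partial>circle_measure) = b k" for k
    unfolding G by simp
  then show ?thesis
    using \<phi> by blast
qed

section \<open>Boundary functions of the Hardy space\<close>

text \<open>
  Bounded second moments give uniform integrability, and with it convergence in mean. For the
  distance \<open>d\<close> to the limit and every \<open>K > 0\<close> there is the bound \<open>d \<le> min d K + d\<^sup>2 / K\<close>:
  the first term tends to 0 in mean by dominated convergence, and the second is small in mean
  for large \<open>K\<close>, uniformly in the index.
\<close>

lemma (in finite_measure) tendsto_integral_L2_bounded:
  fixes f :: "nat \<Rightarrow> 'a \<Rightarrow> complex" and g h :: "'a \<Rightarrow> complex"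
  assumes f [measurable]: "\<And>k. f k \<in> borel_measurable M"
    and f2: "\<And>k. integrable M (\<lambda>x. (cmod (f k x))\<^sup>2)"
    and C: "\<And>k. (\<integral>x. (cmod (f k x))\<^sup>2 \<partial>M) \<le> C"
    and h [measurable]: "h \<in> borel_measurable M"
    and h2: "integrable M (\<lambda>x. (cmod (h x))\<^sup>2)"
    and lim: "AE x in M. (\<lambda>k. f k x) \<longlonglongrightarrow> h x"
    and g [measurable]: "g \<in> borel_measurable M"
    and B: "AE x in M. cmod (g x) \<le> B"
  shows "(\<lambda>k. \<integral>x. f k x * g x \<partial>M) \<longlonglongrightarrow> (\<integral>x. h x * g x \<partial>M)"
proof -
  \<comment> \<open>A common bound for the second moments of the differences; the summand 1 makes it positive.\<close>
  define D where "D = 2 * C + 2 * (\<integral>x. (cmod (h x))\<^sup>2 \<partial>M) + 1"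
  have int1: "integrable M u" if "u \<in> borel_measurable M" "integrable M (\<lambda>x. (cmod (u x))\<^sup>2)"
    for u :: "'a \<Rightarrow> complex"
  proof (rule Bochner_Integration.integrable_bound)
    show "integrable M (\<lambda>x. 1 + (cmod (u x))\<^sup>2)"
      using that by simp
    show "AE x in M. norm (u x) \<le> norm (1 + (cmod (u x))\<^sup>2)"
    proof (intro AE_I2)
      fix x
      have "2 * cmod (u x) \<le> 1 + (cmod (u x))\<^sup>2"
        using sum_squares_bound[of 1 "cmod (u x)"] by simp
      moreover have "0 \<le> cmod (u x)"
        by simp
      ultimately have "cmod (u x) \<le> 1 + (cmod (u x))\<^sup>2"
        by linarith
      then show "norm (u x) \<le> norm (1 + (cmod (u x))\<^sup>2)"
        by simp
    qed
  qed (use that in auto)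
  have sq: "(cmod (f k x - h x))\<^sup>2 \<le> 2 * (cmod (f k x))\<^sup>2 + 2 * (cmod (h x))\<^sup>2" for k x
  proof -
    have "(cmod (f k x - h x))\<^sup>2 \<le> (cmod (f k x) + cmod (h x))\<^sup>2"
      by (intro power_mono norm_triangle_ineq4) auto
    also have "\<dots> \<le> 2 * (cmod (f k x))\<^sup>2 + 2 * (cmod (h x))\<^sup>2"
      using sum_squares_bound[of "cmod (f k x)" "cmod (h x)"] by (simp add: power2_sum)
    finally show ?thesis .
  qed
  have d2: "integrable M (\<lambda>x. (cmod (f k x - h x))\<^sup>2)" for k
    by (rule Bochner_Integration.integrable_bound[where f = "\<lambda>x. 2 * (cmod (f k x))\<^sup>2 + 2 * (cmod (h x))\<^sup>2"])
       (use f2 h2 sq in auto)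
  have D: "(\<integral>x. (cmod (f k x - h x))\<^sup>2 \<partial>M) \<le> D" for k
  proof -
    have "(\<integral>x. (cmod (f k x - h x))\<^sup>2 \<partial>M) \<le> (\<integral>x. 2 * (cmod (f k x))\<^sup>2 + 2 * (cmod (h x))\<^sup>2 \<partial>M)"
      using f2 h2 sq d2 by (intro integral_mono) auto
    also have "\<dots> = 2 * (\<integral>x. (cmod (f k x))\<^sup>2 \<partial>M) + 2 * (\<integral>x. (cmod (h x))\<^sup>2 \<partial>M)"
      using f2 h2 by simp
    finally show ?thesis
      using C[of k] by (simp add: D_def)
  qed
  have "0 \<le> (\<integral>x. (cmod (f 0 x))\<^sup>2 \<partial>M)" "0 \<le> (\<integral>x. (cmod (h x))\<^sup>2 \<partial>M)"
    by (auto intro: integral_nonneg_AE)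
  then have "D > 0"
    using C[of 0] unfolding D_def by linarith
  have d1: "integrable M (\<lambda>x. cmod (f k x - h x))" for k
    using int1[of "\<lambda>x. f k x - h x"] d2 by simp
  have L1: "(\<lambda>k. \<integral>x. cmod (f k x - h x) \<partial>M) \<longlonglongrightarrow> 0"
  proof (rule LIMSEQ_I)
    fix e :: real
    assume "e > 0"
    \<comment> \<open>With this threshold, the quadratic term contributes at most \<open>e / 2\<close>.\<close>
    define K where "K = 2 * D / e"
    have "K > 0"
      using \<open>D > 0\<close> \<open>e > 0\<close> by (simp add: K_def)
    have "(\<lambda>k. \<integral>x. min (cmod (f k x - h x)) K \<partial>M) \<longlonglongrightarrow> (\<integral>x. 0 \<partial>M)"
    proof (rule integral_dominated_convergence)
      show "AE x in M. (\<lambda>k. min (cmod (f k x - h x)) K) \<longlonglongrightarrow> 0"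
        using lim
      proof eventually_elim
        case (elim x)
        have "(\<lambda>k. min (cmod (f k x - h x)) K) \<longlonglongrightarrow> min (cmod (h x - h x)) K"
          by (intro tendsto_intros elim)
        then show ?case
          using \<open>K > 0\<close> by simp
      qed
      show "integrable M (\<lambda>x. K)"
        by simp
      show "AE x in M. norm (min (cmod (f k x - h x)) K) \<le> K" for k
        using \<open>K > 0\<close> by auto
    qed auto
    then have "eventually (\<lambda>k. (\<integral>x. min (cmod (f k x - h x)) K \<partial>M) < e / 2) sequentially"
      by (rule order_tendstoD) (use \<open>e > 0\<close> in auto)
    then obtain N where N: "\<And>k. k \<ge> N \<Longrightarrow> (\<integral>x. min (cmod (f k x - h x)) K \<partial>M) < e / 2"
      by (auto simp: eventually_sequentially)
    show "\<exists>N. \<forall>k\<ge>N. norm ((\<integral>x. cmod (f k x - h x) \<partial>M) - 0) < e"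
    proof (intro exI allI impI)
      fix k
      assume "k \<ge> N"
      have mi: "integrable M (\<lambda>x. min (cmod (f k x - h x)) K)"
        using d1 by simp
      have "(\<integral>x. cmod (f k x - h x) \<partial>M) \<le>
          (\<integral>x. min (cmod (f k x - h x)) K + (cmod (f k x - h x))\<^sup>2 / K \<partial>M)"
      proof (intro integral_mono d1 Bochner_Integration.integrable_add mi)
        show "integrable M (\<lambda>x. (cmod (f k x - h x))\<^sup>2 / K)"
          using d2 by simp
        fix x
        show "cmod (f k x - h x) \<le> min (cmod (f k x - h x)) K + (cmod (f k x - h x))\<^sup>2 / K"
        proof (cases "cmod (f k x - h x) \<le> K")
          case True
          then show ?thesis
            using \<open>K > 0\<close> by simp
        next
          case False
          then have "cmod (f k x - h x) * K \<le> cmod (f k x - h x) * cmod (f k x - h x)"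
            by (intro mult_left_mono) auto
          then have "cmod (f k x - h x) \<le> (cmod (f k x - h x))\<^sup>2 / K"
            using \<open>K > 0\<close> by (simp add: field_simps power2_eq_square)
          then show ?thesis
            using \<open>K > 0\<close> False by simp
        qed
      qed
      also have "\<dots> = (\<integral>x. min (cmod (f k x - h x)) K \<partial>M) + (\<integral>x. (cmod (f k x - h x))\<^sup>2 \<partial>M) / K"
        using mi d2 by simp
      also have "\<dots> < e / 2 + D / K"
        using N[OF \<open>k \<ge> N\<close>] D[of k] \<open>K > 0\<close> by (intro add_less_le_mono divide_right_mono) auto
      also have "\<dots> = e"
        using \<open>D > 0\<close> \<open>e > 0\<close> by (simp add: K_def)
      finally show "norm ((\<integral>x. cmod (f k x - h x) \<partial>M) - 0) < e"
        by (simp add: integral_nonneg_AE)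
    qed
  qed
  have gb: "integrable M (\<lambda>x. u x * g x)" if u: "integrable M u" for u :: "'a \<Rightarrow> complex"
  proof (rule Bochner_Integration.integrable_bound)
    show "integrable M (\<lambda>x. B * cmod (u x))"
      using u by simp
    show "AE x in M. norm (u x * g x) \<le> norm (B * cmod (u x))"
      using B
    proof eventually_elim
      case (elim x)
      then show ?case
        using mult_right_mono[of "cmod (g x)" "\<bar>B\<bar>" "cmod (u x)"]
        by (simp add: norm_mult abs_mult mult.commute)
    qed
  qed (use u in auto)
  have "(\<lambda>k. (\<integral>x. f k x * g x \<partial>M) - (\<integral>x. h x * g x \<partial>M)) \<longlonglongrightarrow> 0"
  proof (rule Lim_null_comparison)
    show "(\<lambda>k. B * (\<integral>x. cmod (f k x - h x) \<partial>M)) \<longlonglongrightarrow> 0"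
      using tendsto_mult_left[OF L1, of B] by simp
    show "eventually (\<lambda>k. norm ((\<integral>x. f k x * g x \<partial>M) - (\<integral>x. h x * g x \<partial>M))
        \<le> B * (\<integral>x. cmod (f k x - h x) \<partial>M)) sequentially"
    proof (intro always_eventually allI)
      fix k
      have "(\<integral>x. f k x * g x \<partial>M) - (\<integral>x. h x * g x \<partial>M) = (\<integral>x. (f k x - h x) * g x \<partial>M)"
        using int1[OF f f2] int1[OF h h2] by (simp add: left_diff_distrib gb)
      also have "norm \<dots> \<le> (\<integral>x. norm ((f k x - h x) * g x) \<partial>M)"
        by (rule integral_norm_bound)
      also have "\<dots> \<le> (\<integral>x. B * cmod (f k x - h x) \<partial>M)"
      proof (rule integral_mono_AE)
        show "integrable M (\<lambda>x. norm ((f k x - h x) * g x))"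
          using gb[of "\<lambda>x. f k x - h x"] int1[OF f f2] int1[OF h h2] by simp
        show "AE x in M. norm ((f k x - h x) * g x) \<le> B * cmod (f k x - h x)"
          using B by eventually_elim (auto simp: norm_mult mult.commute intro: mult_right_mono)
      qed (use d1 in auto)
      finally show "norm ((\<integral>x. f k x * g x \<partial>M) - (\<integral>x. h x * g x \<partial>M))
          \<le> B * (\<integral>x. cmod (f k x - h x) \<partial>M)"
        by simp
    qed
  qed
  then show ?thesis
    by (rule LIM_zero_cancel)
qed

text \<open>
  Continuity up to the boundary makes Cauchy's formula available on the unit circle itself, without
  radial limits.
\<close>

definition disc_algebra :: "(complex \<Rightarrow> complex) \<Rightarrow> bool" where
  "disc_algebra G \<longleftrightarrow> continuous_on (cball 0 1) G \<and> G holomorphic_on ball 0 1"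

lemma disc_algebra_const: "disc_algebra (\<lambda>z. c)"
  and disc_algebra_ident: "disc_algebra (\<lambda>z. z)"
  by (auto simp: disc_algebra_def)

lemma disc_algebra_mult:
  "disc_algebra F \<Longrightarrow> disc_algebra G \<Longrightarrow> disc_algebra (\<lambda>z. F z * G z)"
  by (auto simp: disc_algebra_def intro!: continuous_intros holomorphic_intros)

lemma disc_algebra_prod:
  "(\<And>i. i \<in> I \<Longrightarrow> disc_algebra (F i)) \<Longrightarrow> disc_algebra (\<lambda>z. \<Prod>i\<in>I. F i z)"
  by (auto simp: disc_algebra_def intro!: continuous_intros holomorphic_intros)

lemma disc_algebra_sum:
  "(\<And>i. i \<in> I \<Longrightarrow> disc_algebra (F i)) \<Longrightarrow> disc_algebra (\<lambda>z. \<Sum>i\<in>I. F i z)"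
  by (auto simp: disc_algebra_def intro!: continuous_intros holomorphic_intros)

lemma one_minus_cnj_mult_nonzero:
  assumes "cmod a < 1" "cmod z \<le> 1"
  shows "1 - cnj a * z \<noteq> 0"
proof
  assume "1 - cnj a * z = 0"
  then have "cmod a * cmod z = 1"
    by (metis complex_mod_cnj eq_iff_diff_eq_0 norm_mult norm_one)
  moreover have "cmod a * cmod z \<le> cmod a * 1"
    using assms by (intro mult_left_mono) auto
  ultimately show False
    using assms by simp
qed

lemma one_minus_mult_cnj_nonzero:
  assumes "cmod a < 1" "cmod z \<le> 1"
  shows "1 - a * cnj z \<noteq> 0"
  using one_minus_cnj_mult_nonzero[of "cnj a" "cnj z"] assms by simp

lemma disc_algebra_divide_one_minus:
  assumes "disc_algebra F" "cmod a < 1"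
  shows "disc_algebra (\<lambda>z. F z / (1 - cnj a * z))"
  using assms one_minus_cnj_mult_nonzero[OF assms(2)]
  by (auto simp: disc_algebra_def intro!: continuous_intros holomorphic_intros)

lemma disc_algebra_continuous_sphere: "disc_algebra G \<Longrightarrow> continuous_on (sphere 0 1) G"
  by (auto simp: disc_algebra_def intro: continuous_on_subset)

lemma continuous_sphere_Linf:
  assumes "continuous_on (sphere 0 1) f"
  shows "f \<in> Linf_circle"
proof -
  have "bounded (f ` sphere 0 1)"
    by (intro compact_imp_bounded compact_continuous_image assms) simp
  then obtain C where "\<forall>z\<in>sphere 0 1. cmod (f z) \<le> C"
    by (auto simp: bounded_iff)
  then have "AE z in circle_measure. cmod (f z) \<le> C"
    by (intro AE_I2) simp
  then show ?thesis
    using borel_measurable_circle_continuous[OF assms] by (auto simp: Linf_circle_def)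
qed

lemma disc_algebra_L2: "disc_algebra G \<Longrightarrow> G \<in> L2_circle"
  by (intro Linf_circle_imp_L2_circle continuous_sphere_Linf disc_algebra_continuous_sphere)

text \<open>
  Cauchy's formula; \<open>du / (2 * pi * \<i> * (u - \<mu>))\<close> is normalized arc length with the
  density \<open>z / (z - \<mu>)\<close>.
\<close>

lemma disc_algebra_Cauchy:
  assumes G: "disc_algebra G" and l: "cmod \<mu> < 1"
  shows "(\<integral>z. G z * (z / (z - \<mu>)) \<partial>circle_measure) = G \<mu>"
proof -
  have "((\<lambda>u. G u / (u - \<mu>)) has_contour_integral 2 * of_real pi * \<i> * G \<mu>) (part_circlepath 0 1 0 (2 * pi))"
    using Cauchy_integral_circlepath[of 0 1 G \<mu>] G l
    by (simp add: disc_algebra_def circlepath_def)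
  then have "((\<lambda>t. G (cis t) / (cis t - \<mu>) * \<i> * cis t) has_integral 2 * of_real pi * \<i> * G \<mu>) {0..2 * pi}"
    by (subst (asm) has_contour_integral_part_circlepath_iff) auto
  from has_integral_mult_right[OF this, of "- \<i>"]
  have "((\<lambda>t. G (cis t) * (cis t / (cis t - \<mu>))) has_integral 2 * of_real pi * G \<mu>) {0..2 * pi}"
    by (simp add: mult_ac)
  moreover have "continuous_on (sphere 0 1) (\<lambda>z. G z * (z / (z - \<mu>)))"
    using l by (auto intro!: continuous_intros disc_algebra_continuous_sphere[OF G])
  ultimately show ?thesis
    by (simp add: circle_integral_continuous integral_unique)
qed

text \<open>
  The conditions in the definition of the Hardy space, as a relation between a holomorphic function
  in the disc and its boundary function, so that the two can be spoken of together.
\<close>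

definition hardy_extension :: "(complex \<Rightarrow> complex) \<Rightarrow> (complex \<Rightarrow> complex) \<Rightarrow> bool" where
  "hardy_extension F h \<longleftrightarrow> F holomorphic_on ball 0 1 \<and>
     bdd_above ((\<lambda>r. \<integral>z. (cmod (F (complex_of_real r * z)))\<^sup>2 \<partial>circle_measure) ` {0..<1}) \<and>
     (AE z in circle_measure. ((\<lambda>r. F (complex_of_real r * z)) \<longlongrightarrow> h z) (at_left 1))"

lemma hardy2_iff: "h \<in> hardy2 \<longleftrightarrow> h \<in> L2_circle \<and> (\<exists>F. hardy_extension F h)"
  by (auto simp: hardy2_def hardy_extension_def)

lemma disc_algebra_hardy_extension:
  assumes G: "disc_algebra G"
  shows "hardy_extension G G"
proof -
  have c: "continuous_on (cball 0 1) G"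
    using G by (simp add: disc_algebra_def)
  have "bounded (G ` cball 0 1)"
    by (intro compact_imp_bounded compact_continuous_image c) simp
  then obtain B where B: "\<And>z. z \<in> cball 0 1 \<Longrightarrow> cmod (G z) \<le> B"
    unfolding bounded_iff by blast
  have rz: "cmod (complex_of_real r * z) \<le> 1" if "0 \<le> r" "r \<le> 1" "cmod z = 1" for r z
    using that by (simp add: norm_mult)
  have "(\<integral>z. (cmod (G (complex_of_real r * z)))\<^sup>2 \<partial>circle_measure) \<le>
      (\<integral>z. B\<^sup>2 \<partial>circle_measure)" if r: "r \<in> {0..<1}" for r
  proof (rule integral_mono_AE)
    have "continuous_on (sphere 0 1) (\<lambda>z. G (complex_of_real r * z))"
      by (rule continuous_on_compose2[OF c]) (use r rz in \<open>auto intro!: continuous_intros\<close>)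
    then show "integrable circle_measure (\<lambda>z. (cmod (G (complex_of_real r * z)))\<^sup>2)"
      using Linf_circle_imp_L2_circle[OF continuous_sphere_Linf] by (simp add: L2_circle_def)
    show "AE z in circle_measure. (cmod (G (complex_of_real r * z)))\<^sup>2 \<le> B\<^sup>2"
      by (intro AE_I2 power_mono B) (use r rz in auto)
  qed simp
  moreover have "((\<lambda>r. G (complex_of_real r * z)) \<longlongrightarrow> G z) (at_left 1)" if "z \<in> sphere 0 1" for z
  proof -
    have "continuous_on {0..1} (\<lambda>r. G (complex_of_real r * z))"
      by (rule continuous_on_compose2[OF c]) (use rz that in \<open>auto intro!: continuous_intros\<close>)
    from continuous_on_Icc_at_leftD[OF this] show ?thesis
      by simp
  qed
  ultimately show ?thesis
    using G unfolding hardy_extension_def disc_algebra_def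
    by (auto simp del: integral_const lebesgue_integral_const intro!: AE_I2
        bdd_aboveI2[of _ _ "\<integral>z. B\<^sup>2 \<partial>circle_measure"])
qed

lemma disc_algebra_hardy2: "disc_algebra G \<Longrightarrow> G \<in> hardy2"
  using disc_algebra_L2 disc_algebra_hardy_extension by (auto simp: hardy2_iff)

text \<open>
  With a dilate of \<open>F\<close>, which is continuous on the closed disc, in place of \<open>h\<close> this is Cauchy's
  formula, except that \<open>F\<close> is evaluated at a point between 0 and \<open>\<mu>\<close>, which tends to \<open>\<mu>\<close>. The
  dilates have bounded second moments and tend to \<open>h\<close> almost everywhere, so the integrals converge.
\<close>

lemma hardy_pairing:
  assumes h: "h \<in> L2_circle" and F: "hardy_extension F h" and R: "disc_algebra R"
    and l: "cmod \<mu> < 1"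
  shows "(\<integral>z. h z * (R z * (z / (z - \<mu>))) \<partial>circle_measure) = F \<mu> * R \<mu>"
proof -
  define r where "r k = 1 - 1 / (real k + 2)" for k
  have r: "0 \<le> r k" "r k < 1" for k
    by (auto simp: r_def field_simps)
  have r1: "r \<longlonglongrightarrow> 1"
    unfolding r_def by real_asymp
  have rl: "filterlim r (at_left 1) sequentially"
    unfolding filterlim_at using r r1 by (auto intro!: always_eventually simp: less_imp_neq)
  have Fh: "F holomorphic_on ball 0 1"
    using F by (simp add: hardy_extension_def)
  have rz: "cmod (of_real (r k) * z) < 1" if "cmod z \<le> 1" for k z
  proof -
    have "r k * cmod z \<le> r k * 1"
      using r that by (intro mult_left_mono) auto
    then show ?thesis
      using r[of k] by (simp add: norm_mult)
  qed
  have Fk: "disc_algebra (\<lambda>z. F (of_real (r k) * z))" for k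
    unfolding disc_algebra_def
  proof
    show "continuous_on (cball 0 1) (\<lambda>z. F (of_real (r k) * z))"
      by (rule continuous_on_compose2[OF holomorphic_on_imp_continuous_on[OF Fh]])
         (use rz in \<open>auto intro!: continuous_intros\<close>)
    show "(\<lambda>z. F (of_real (r k) * z)) holomorphic_on ball 0 1"
      by (rule holomorphic_on_compose_gen[OF _ Fh, unfolded o_def])
         (use rz in \<open>auto intro!: holomorphic_intros\<close>)
  qed
  have gc: "continuous_on (sphere 0 1) (\<lambda>z. R z * (z / (z - \<mu>)))"
    using l by (auto intro!: continuous_intros disc_algebra_continuous_sphere[OF R])
  from continuous_sphere_Linf[OF gc] obtain B
    where B: "AE z in circle_measure. cmod (R z * (z / (z - \<mu>))) \<le> B"
    by (auto simp: Linf_circle_def)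
  from F obtain C where C: "\<And>s. s \<in> {0..<1} \<Longrightarrow>
      (\<integral>z. (cmod (F (complex_of_real s * z)))\<^sup>2 \<partial>circle_measure) \<le> C"
    unfolding hardy_extension_def bdd_above_def by blast
  have "(\<lambda>k. \<integral>z. F (of_real (r k) * z) * (R z * (z / (z - \<mu>))) \<partial>circle_measure)
      \<longlonglongrightarrow> (\<integral>z. h z * (R z * (z / (z - \<mu>))) \<partial>circle_measure)"
  proof (rule circle.tendsto_integral_L2_bounded)
    show "(\<lambda>z. F (of_real (r k) * z)) \<in> borel_measurable circle_measure"
      "integrable circle_measure (\<lambda>z. (cmod (F (of_real (r k) * z)))\<^sup>2)" for k
      using disc_algebra_L2[OF Fk] by (auto simp: L2_circle_def)
    show "(\<integral>z. (cmod (F (of_real (r k) * z)))\<^sup>2 \<partial>circle_measure) \<le> C" for k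
      using r by (intro C) auto
    show "h \<in> borel_measurable circle_measure" "integrable circle_measure (\<lambda>z. (cmod (h z))\<^sup>2)"
      using h by (auto simp: L2_circle_def)
    have "AE z in circle_measure. ((\<lambda>r. F (complex_of_real r * z)) \<longlongrightarrow> h z) (at_left 1)"
      using F by (simp add: hardy_extension_def)
    then show "AE z in circle_measure. (\<lambda>k. F (of_real (r k) * z)) \<longlonglongrightarrow> h z"
      by eventually_elim (rule filterlim_compose[OF _ rl])
  qed (use B borel_measurable_circle_continuous[OF gc] in auto)
  moreover have "(\<integral>z. F (of_real (r k) * z) * (R z * (z / (z - \<mu>))) \<partial>circle_measure)
      = F (of_real (r k) * \<mu>) * R \<mu>" for k
    using disc_algebra_Cauchy[OF disc_algebra_mult[OF Fk R] l] by (simp add: mult.assoc)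
  moreover have "(\<lambda>k. F (of_real (r k) * \<mu>) * R \<mu>) \<longlonglongrightarrow> F \<mu> * R \<mu>"
  proof -
    have "isCont F \<mu>"
      using holomorphic_on_imp_continuous_on[OF Fh] l by (simp add: continuous_on_eq_continuous_at)
    moreover have "(\<lambda>k. of_real (r k) * \<mu>) \<longlonglongrightarrow> of_real 1 * \<mu>"
      by (intro tendsto_intros r1)
    ultimately show ?thesis
      by (intro tendsto_intros isCont_tendsto_compose[of _ F]) auto
  qed
  ultimately show ?thesis
    using LIMSEQ_unique by simp blast
qed

text \<open>
  The form in which orthogonality in the Hardy space is used: an integrand that is holomorphic and
  vanishes at the origin has mean 0.
\<close>

lemma hardy_pairing_zero:
  assumes "h \<in> hardy2" "disc_algebra R"
  shows "(\<integral>z. h z * (z * R z) \<partial>circle_measure) = 0"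
proof -
  obtain F where h: "h \<in> L2_circle" "hardy_extension F h"
    using assms(1) by (auto simp: hardy2_iff)
  have "(\<integral>z. h z * (z * R z) \<partial>circle_measure) =
      (\<integral>z. h z * (z * R z * (z / (z - 0))) \<partial>circle_measure)"
    by (intro Bochner_Integration.integral_cong) auto
  also have "\<dots> = 0"
    using hardy_pairing[OF h disc_algebra_mult[OF disc_algebra_ident assms(2)], of 0] by simp
  finally show ?thesis .
qed

lemma model_space_L2: "h \<in> model_space \<theta> \<Longrightarrow> h \<in> L2_circle"
  by (simp add: model_space_def hardy2_def)

lemma model_space_cong_AE:
  assumes f: "f \<in> model_space \<theta>" and \<theta>: "\<theta> \<in> Linf_circle"
    and g: "g \<in> borel_measurable circle_measure" and fg: "AE z in circle_measure. f z = g z"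
  shows "g \<in> model_space \<theta>"
proof -
  have f2: "f \<in> L2_circle"
    using f by (simp add: model_space_def hardy2_def)
  have "integrable circle_measure (\<lambda>z. (cmod (g z))\<^sup>2) \<longleftrightarrow>
      integrable circle_measure (\<lambda>z. (cmod (f z))\<^sup>2)"
    by (rule integrable_cong_AE) (use f2 g fg in \<open>auto simp: L2_circle_def\<close>)
  then have g2: "g \<in> L2_circle"
    using f2 g by (simp add: L2_circle_def)
  obtain F where F: "hardy_extension F f"
    using f by (auto simp: model_space_def hardy2_iff)
  have "AE z in circle_measure. ((\<lambda>r. F (complex_of_real r * z)) \<longlongrightarrow> f z) (at_left 1)"
    using F by (simp add: hardy_extension_def)
  with fg have "AE z in circle_measure. ((\<lambda>r. F (complex_of_real r * z)) \<longlongrightarrow> g z) (at_left 1)"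
    by eventually_elim simp
  then have "hardy_extension F g"
    using F by (simp add: hardy_extension_def)
  moreover have "L2_inner g (\<lambda>z. \<theta> z * h z) = 0" if h: "h \<in> hardy2" for h
  proof -
    have "(\<lambda>z. \<theta> z * h z) \<in> L2_circle"
      using \<theta> h by (intro L2_circle_Linf_mult) (auto simp: hardy2_def)
    then have "L2_inner g (\<lambda>z. \<theta> z * h z) = L2_inner f (\<lambda>z. \<theta> z * h z)"
      by (intro L2_inner_cong_AE L2_circle_measurable g2 f2) (use fg in auto)
    then show ?thesis
      using f h by (simp add: model_space_def)
  qed
  ultimately show ?thesis
    using g2 by (auto simp: model_space_def hardy2_iff)
qed

section \<open>Finite Blaschke products and the Takenaka functions\<close>

definition blaschke_factor :: "complex \<Rightarrow> complex \<Rightarrow> complex" where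
  "blaschke_factor a z = (z - a) / (1 - cnj a * z)"

text \<open>
  This identity makes the sum over the Takenaka functions telescope. For \<open>z = \<zeta>\<close> on the circle it says
  that the factor is unimodular there.
\<close>

lemma one_minus_blaschke_factors:
  assumes a: "cmod a < 1" and z: "cmod z \<le> 1" and w: "cmod \<zeta> \<le> 1"
  shows "1 - cnj (blaschke_factor a \<zeta>) * blaschke_factor a z =
    of_real (1 - (cmod a)\<^sup>2) * (1 - cnj \<zeta> * z) / ((1 - a * cnj \<zeta>) * (1 - cnj a * z))"
proof -
  have "1 - cnj a * z \<noteq> 0" "1 - a * cnj \<zeta> \<noteq> 0"
    using one_minus_cnj_mult_nonzero[OF a z] one_minus_mult_cnj_nonzero[OF a w] by auto
  then have "1 - cnj (blaschke_factor a \<zeta>) * blaschke_factor a z =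
      ((1 - a * cnj \<zeta>) * (1 - cnj a * z) - (cnj \<zeta> - cnj a) * (z - a)) / ((1 - a * cnj \<zeta>) * (1 - cnj a * z))"
    by (simp add: blaschke_factor_def
        diff_divide_distrib[where c = "(1 - a * cnj \<zeta>) * (1 - cnj a * z)"])
  also have "(1 - a * cnj \<zeta>) * (1 - cnj a * z) - (cnj \<zeta> - cnj a) * (z - a) =
      (1 - a * cnj a) * (1 - cnj \<zeta> * z)"
    by (simp add: algebra_simps)
  also have "1 - a * cnj a = of_real (1 - (cmod a)\<^sup>2)"
    using complex_norm_square[of a] by simp
  finally show ?thesis .
qed

lemma blaschke_factor_circle:
  assumes "cmod a < 1" "cmod z = 1"
  shows "cnj (blaschke_factor a z) * blaschke_factor a z = 1"
  using one_minus_blaschke_factors[of a z z] assms complex_norm_square[of z]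
  by (simp add: mult.commute)

lemma disc_algebra_blaschke_factor:
  assumes "cmod a < 1"
  shows "disc_algebra (blaschke_factor a)"
  unfolding blaschke_factor_def
  by (intro disc_algebra_divide_one_minus assms)
     (auto simp: disc_algebra_def intro!: continuous_intros holomorphic_intros)

locale finite_blaschke =
  fixes n :: nat and c :: complex and a :: "nat \<Rightarrow> complex"
  assumes c: "cmod c = 1" and a: "i < n \<Longrightarrow> cmod (a i) < 1"
begin

definition \<Theta> :: "complex \<Rightarrow> complex" where
  "\<Theta> z = c * (\<Prod>i<n. blaschke_factor (a i) z)"

text \<open>
  The Takenaka-Malmquist functions, an orthonormal basis of the model space.
\<close>

definition takenaka :: "nat \<Rightarrow> complex \<Rightarrow> complex" where
  "takenaka j z = of_real (sqrt (1 - (cmod (a j))\<^sup>2)) / (1 - cnj (a j) * z) *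
     (\<Prod>i<j. blaschke_factor (a i) z)"

definition repro_kernel :: "complex \<Rightarrow> complex \<Rightarrow> complex" where
  "repro_kernel \<zeta> z = (\<Sum>j<n. cnj (takenaka j \<zeta>) * takenaka j z)"

lemma disc_algebra_Theta: "disc_algebra \<Theta>"
  unfolding \<Theta>_def
  by (intro disc_algebra_mult disc_algebra_const disc_algebra_prod disc_algebra_blaschke_factor a) auto

lemma disc_algebra_takenaka:
  assumes "j < n"
  shows "disc_algebra (takenaka j)"
  unfolding takenaka_def
  by (intro disc_algebra_mult disc_algebra_const disc_algebra_prod disc_algebra_blaschke_factor
      disc_algebra_divide_one_minus a) (use assms in auto)

lemma disc_algebra_takenaka_sum: "disc_algebra (\<lambda>z. \<Sum>j<n. k j * takenaka j z)"
  by (intro disc_algebra_sum disc_algebra_mult disc_algebra_const disc_algebra_takenaka) auto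

lemma Theta_Linf: "\<Theta> \<in> Linf_circle"
  by (intro continuous_sphere_Linf disc_algebra_continuous_sphere disc_algebra_Theta)

text \<open>
  The summand with index \<open>m\<close>, multiplied by \<open>1 - cnj \<zeta> * z\<close>, is the difference of two consecutive
  partial products of the factors. The formula has no singularity on the circle, which is why the
  kernel is represented by the sum rather than by the quotient.
\<close>

lemma repro_kernel_eq:
  assumes z: "cmod z \<le> 1" and w: "cmod \<zeta> \<le> 1"
  shows "repro_kernel \<zeta> z * (1 - cnj \<zeta> * z) = 1 - cnj (\<Theta> \<zeta>) * \<Theta> z"
proof -
  let ?p = "\<lambda>m. \<Prod>i<m. cnj (blaschke_factor (a i) \<zeta>) * blaschke_factor (a i) z"
  have "(\<Sum>j<m. cnj (takenaka j \<zeta>) * takenaka j z) * (1 - cnj \<zeta> * z) = 1 - ?p m" if "m \<le> n" for m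
    using that
  proof (induction m)
    case (Suc m)
    have am: "cmod (a m) < 1"
      using a Suc.prems by auto
    let ?s = "complex_of_real (sqrt (1 - (cmod (a m))\<^sup>2))"
    have "sqrt (1 - (cmod (a m))\<^sup>2) * sqrt (1 - (cmod (a m))\<^sup>2) = 1 - (cmod (a m))\<^sup>2"
      using am by (simp add: power_le_one)
    then have ss: "?s * ?s = of_real (1 - (cmod (a m))\<^sup>2)"
      by (metis of_real_mult)
    have "cnj (takenaka m \<zeta>) * takenaka m z * (1 - cnj \<zeta> * z) = ?s * ?s *
        (1 - cnj \<zeta> * z) / ((1 - a m * cnj \<zeta>) * (1 - cnj (a m) * z)) * ?p m"
      by (simp add: takenaka_def prod.distrib cnj_prod)
    also have "\<dots> = (1 - cnj (blaschke_factor (a m) \<zeta>) * blaschke_factor (a m) z) * ?p m"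
      unfolding ss one_minus_blaschke_factors[OF am z w] ..
    also have "\<dots> = ?p m - ?p (Suc m)"
      by (simp add: algebra_simps)
    finally show ?case
      using Suc by (simp add: distrib_right)
  qed simp
  from this[of n] have "repro_kernel \<zeta> z * (1 - cnj \<zeta> * z) = 1 - ?p n"
    by (simp add: repro_kernel_def)
  moreover have "cnj (\<Theta> \<zeta>) * \<Theta> z = cnj c * c * ?p n"
    by (simp add: \<Theta>_def prod.distrib cnj_prod)
  moreover have "cnj c * c = 1"
    using complex_norm_square[of c] c by (simp add: mult.commute)
  ultimately show ?thesis
    by simp
qed

lemma Theta_circle:
  assumes "cmod z = 1"
  shows "\<Theta> z * cnj (\<Theta> z) = 1"
  using repro_kernel_eq[of z z] assms complex_norm_square[of z] by (simp add: mult.commute)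

section \<open>The model space of a finite Blaschke product\<close>

text \<open>
  On the circle, conjugation inverts the Blaschke factors. In \<open>\<Theta> * cnj (takenaka j)\<close> the
  factors with index below \<open>j\<close> cancel, and the pole of the conjugated fraction is cancelled by
  the zero of factor \<open>j\<close>. What is left is \<open>z\<close> times a function that is holomorphic in the disc, so its
  integral against a Hardy function vanishes.
\<close>

lemma takenaka_model_space:
  assumes j: "j < n"
  shows "takenaka j \<in> model_space \<Theta>"
proof -
  define R where "R z = c * of_real (sqrt (1 - (cmod (a j))\<^sup>2)) *
      (\<Prod>i\<in>{j<..<n}. blaschke_factor (a i) z) / (1 - cnj (a j) * z)" for z
  have R: "disc_algebra R"
    unfolding R_def
    by (intro disc_algebra_mult disc_algebra_const disc_algebra_prod disc_algebra_blaschke_factor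
        disc_algebra_divide_one_minus a) (use j in auto)
  have eq: "\<Theta> z * cnj (takenaka j z) = z * R z" if z: "cmod z = 1" for z
  proof -
    have zz: "z * cnj z = 1"
      using complex_norm_square[of z] z by simp
    have n0: "1 - a j * cnj z \<noteq> 0"
      using one_minus_mult_cnj_nonzero[OF a[OF j], of z] z by simp
    have za: "z - a j = z * (1 - a j * cnj z)"
      using zz by (simp add: algebra_simps)
    have n: "{..<n} = insert j ({..<j} \<union> {j<..<n})"
      using j by auto
    have split: "(\<Prod>i<n. blaschke_factor (a i) z) = (\<Prod>i<j. blaschke_factor (a i) z) *
        blaschke_factor (a j) z * (\<Prod>i\<in>{j<..<n}. blaschke_factor (a i) z)"
      unfolding n by (subst prod.insert, simp, simp, subst prod.union_disjoint) (auto simp: mult_ac)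
    have one: "cnj (\<Prod>i<j. blaschke_factor (a i) z) * (\<Prod>i<j. blaschke_factor (a i) z) = 1"
      using j z a by (simp add: cnj_prod prod.distrib[symmetric] blaschke_factor_circle)
    let ?s = "of_real (sqrt (1 - (cmod (a j))\<^sup>2)) :: complex"
    let ?q = "\<Prod>i\<in>{j<..<n}. blaschke_factor (a i) z"
    have "\<Theta> z * cnj (takenaka j z) = c * ?s * ?q * (blaschke_factor (a j) z / (1 - a j * cnj z)) *
        (cnj (\<Prod>i<j. blaschke_factor (a i) z) * (\<Prod>i<j. blaschke_factor (a i) z))"
      by (simp add: \<Theta>_def takenaka_def split mult_ac)
    also have "blaschke_factor (a j) z / (1 - a j * cnj z) = z / (1 - cnj (a j) * z)"
      unfolding blaschke_factor_def za using n0 by simp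
    finally show ?thesis
      unfolding one by (simp add: R_def mult_ac)
  qed
  have "L2_inner (takenaka j) (\<lambda>z. \<Theta> z * h z) = 0" if h: "h \<in> hardy2" for h
  proof -
    have "L2_inner (\<lambda>z. \<Theta> z * h z) (takenaka j) = (\<integral>z. h z * (z * R z) \<partial>circle_measure)"
      unfolding L2_inner_def
      by (intro Bochner_Integration.integral_cong refl) (simp add: eq[symmetric] mult_ac)
    then show ?thesis
      using hardy_pairing_zero[OF h R] by (subst L2_inner_commute) simp
  qed
  then show ?thesis
    using disc_algebra_hardy2[OF disc_algebra_takenaka[OF j]] by (simp add: model_space_def)
qed

lemma takenaka_L2: "j < n \<Longrightarrow> takenaka j \<in> L2_circle"
  by (intro disc_algebra_L2 disc_algebra_takenaka)

lemma takenaka_sum_model_space: "(\<lambda>z. \<Sum>j<n. k j * takenaka j z) \<in> model_space \<Theta>"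
proof -
  have "L2_inner (\<lambda>z. \<Sum>j<n. k j * takenaka j z) (\<lambda>z. \<Theta> z * h z) = 0" if h: "h \<in> hardy2" for h
  proof -
    have "(\<lambda>z. \<Theta> z * h z) \<in> L2_circle"
      using h by (intro L2_circle_Linf_mult Theta_Linf) (simp add: hardy2_def)
    then show ?thesis
      using takenaka_model_space h by (subst L2_inner_sum_left) (auto simp: takenaka_L2 model_space_def)
  qed
  then show ?thesis
    using disc_algebra_hardy2[OF disc_algebra_takenaka_sum] by (simp add: model_space_def)
qed

text \<open>
  On the circle the kernel at \<open>\<mu>\<close> is the Cauchy kernel minus a multiple of \<open>\<Theta>\<close> times the Cauchy kernel.
  The first part evaluates the holomorphic extension at \<open>\<mu>\<close>, and the second is orthogonal to the
  model space.
\<close>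

lemma model_space_reproducing:
  assumes h: "h \<in> model_space \<Theta>" and F: "hardy_extension F h" and m: "cmod \<mu> < 1"
  shows "F \<mu> = (\<Sum>j<n. L2_inner h (takenaka j) * takenaka j \<mu>)"
proof -
  have h2: "h \<in> L2_circle"
    using h by (rule model_space_L2)
  define s where "s z = 1 / (1 - cnj \<mu> * z)" for z
  have s: "disc_algebra s"
    unfolding s_def by (intro disc_algebra_divide_one_minus disc_algebra_const m)
  have "L2_inner h s = (\<integral>z. h z * (1 * (z / (z - \<mu>))) \<partial>circle_measure)"
    unfolding L2_inner_def
  proof (intro Bochner_Integration.integral_cong refl)
    fix z
    assume "z \<in> space circle_measure"
    then have z: "cmod z = 1"
      by simp
    then have "z * cnj z = 1"
      using complex_norm_square[of z] by simp
    then have "z - \<mu> = z * (1 - \<mu> * cnj z)"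
      by (simp add: algebra_simps)
    moreover have "z \<noteq> 0"
      using z by auto
    ultimately show "h z * cnj (s z) = h z * (1 * (z / (z - \<mu>)))"
      by (simp add: s_def)
  qed
  also have "\<dots> = F \<mu>"
    using hardy_pairing[OF h2 F disc_algebra_const m, of 1] by simp
  finally have 1: "L2_inner h s = F \<mu>" .
  have 2: "L2_inner h (\<lambda>z. \<Theta> z * (cnj (\<Theta> \<mu>) * s z)) = 0"
    using h disc_algebra_hardy2[OF disc_algebra_mult[OF disc_algebra_const s]]
    by (simp add: model_space_def)
  have t2: "(\<lambda>z. \<Theta> z * (cnj (\<Theta> \<mu>) * s z)) \<in> L2_circle"
    by (intro L2_circle_Linf_mult Theta_Linf disc_algebra_L2 disc_algebra_mult disc_algebra_const s)
  have "(\<Sum>j<n. L2_inner h (takenaka j) * takenaka j \<mu>) = L2_inner h (repro_kernel \<mu>)"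
    unfolding repro_kernel_def by (subst L2_inner_sum_right) (auto simp: takenaka_L2 h2 mult.commute)
  also have "\<dots> = L2_inner h (\<lambda>z. s z - \<Theta> z * (cnj (\<Theta> \<mu>) * s z))"
    unfolding L2_inner_def
  proof (intro Bochner_Integration.integral_cong refl arg_cong2[of _ _ _ _ "(*)"] arg_cong[of _ _ cnj])
    fix z
    assume "z \<in> space circle_measure"
    then have "1 - cnj \<mu> * z \<noteq> 0" "repro_kernel \<mu> z * (1 - cnj \<mu> * z) = 1 - cnj (\<Theta> \<mu>) * \<Theta> z"
      using one_minus_cnj_mult_nonzero[OF m, of z] repro_kernel_eq[of z \<mu>] m by auto
    then show "repro_kernel \<mu> z = s z - \<Theta> z * (cnj (\<Theta> \<mu>) * s z)"
      by (simp add: s_def field_simps)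
  qed
  also have "\<dots> = L2_inner h s - L2_inner h (\<lambda>z. \<Theta> z * (cnj (\<Theta> \<mu>) * s z))"
    using L2_inner_diff_left[OF disc_algebra_L2[OF s] t2 h2]
    by (subst (1 2 3) L2_inner_commute) simp
  finally show ?thesis
    using 1 2 by simp
qed

text \<open>
  Both sides are radial limits of the same holomorphic function.
\<close>

lemma model_space_expansion:
  assumes h: "h \<in> model_space \<Theta>"
  shows "AE z in circle_measure. h z = (\<Sum>j<n. L2_inner h (takenaka j) * takenaka j z)"
proof -
  obtain F where F: "hardy_extension F h"
    using h by (auto simp: model_space_def hardy2_iff)
  let ?G = "\<lambda>z. \<Sum>j<n. L2_inner h (takenaka j) * takenaka j z"
  have "AE z in circle_measure. ((\<lambda>r. F (complex_of_real r * z)) \<longlongrightarrow> h z) (at_left 1)"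
    using F by (simp add: hardy_extension_def)
  moreover have "AE z in circle_measure. ((\<lambda>r. ?G (complex_of_real r * z)) \<longlongrightarrow> ?G z) (at_left 1)"
    using disc_algebra_hardy_extension[OF disc_algebra_takenaka_sum] by (simp add: hardy_extension_def)
  ultimately show ?thesis
  using AE_space
  proof eventually_elim
    case (elim z)
    have "eventually (\<lambda>r. ?G (complex_of_real r * z) = F (complex_of_real r * z)) (at_left 1)"
      using eventually_at_left_real[of 0 "1::real", OF zero_less_one]
    proof eventually_elim
      case (elim r)
      then have "cmod (complex_of_real r * z) < 1"
        using \<open>z \<in> space circle_measure\<close> by (simp add: norm_mult)
      then show ?case
        using model_space_reproducing[OF h F] by simp
    qed
    then have "((\<lambda>r. F (complex_of_real r * z)) \<longlongrightarrow> ?G z) (at_left 1)"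
      using elim(2) by (rule Lim_transform_eventually[rotated])
    with elim(1) show ?case
      by (intro tendsto_unique[of "at_left (1::real)"]) auto
  qed
qed

text \<open>
  The candidate is the sum of \<open>L2_inner f (takenaka j) * takenaka j\<close>. Expanding \<open>takenaka i\<close> by
  \<open>model_space_expansion\<close> shows that the candidate and \<open>f\<close> have the same inner product with
  \<open>takenaka i\<close>, and these inner products determine those with every element of the model space.
\<close>

lemma model_projection_exists:
  assumes f: "f \<in> L2_circle"
  shows "\<exists>g. g \<in> model_space \<Theta> \<and> (\<forall>h\<in>model_space \<Theta>. L2_inner (\<lambda>z. f z - g z) h = 0)"
proof (intro exI conjI ballI)
  let ?g = "\<lambda>z. \<Sum>j<n. L2_inner f (takenaka j) * takenaka j z"
  show g: "?g \<in> model_space \<Theta>"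
    by (rule takenaka_sum_model_space)
  have g2: "?g \<in> L2_circle"
    using g by (rule model_space_L2)
  have expand: "L2_inner u h = (\<Sum>j<n. L2_inner u (takenaka j) * cnj (L2_inner h (takenaka j)))"
    if u: "u \<in> L2_circle" and h: "h \<in> model_space \<Theta>" for u h
  proof -
    have "L2_inner u h = L2_inner u (\<lambda>z. \<Sum>j<n. L2_inner h (takenaka j) * takenaka j z)"
      by (intro L2_inner_cong_AE L2_circle_measurable u model_space_L2[OF h]
          model_space_L2[OF takenaka_sum_model_space] model_space_expansion h AE_I2 refl)
    then show ?thesis
      by (subst (asm) L2_inner_sum_right) (auto simp: takenaka_L2 u mult.commute)
  qed
  have "L2_inner ?g (takenaka i) = L2_inner f (takenaka i)" if i: "i < n" for i
  proof -
    have "L2_inner ?g (takenaka i) = (\<Sum>j<n. L2_inner f (takenaka j) * L2_inner (takenaka j) (takenaka i))"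
      using i by (subst L2_inner_sum_left) (auto simp: takenaka_L2)
    also have "\<dots> = (\<Sum>j<n. L2_inner f (takenaka j) * cnj (L2_inner (takenaka i) (takenaka j)))"
      by (subst (2) L2_inner_commute) simp
    finally show ?thesis
      using expand[OF f takenaka_model_space[OF i]] by simp
  qed
  then show "L2_inner (\<lambda>z. f z - ?g z) h = 0" if h: "h \<in> model_space \<Theta>" for h
    using expand[OF f h] expand[OF g2 h] L2_inner_diff_left[OF f g2 model_space_L2[OF h]] by simp
qed

lemma
  assumes f: "f \<in> L2_circle"
  shows model_proj_in_model_space: "model_proj \<Theta> f \<in> model_space \<Theta>"
    and L2_inner_model_proj: "h \<in> model_space \<Theta> \<Longrightarrow> L2_inner (model_proj \<Theta> f) h = L2_inner f h"
proof -
  have *: "model_proj \<Theta> f \<in> model_space \<Theta> \<and>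
      (\<forall>h\<in>model_space \<Theta>. L2_inner (\<lambda>z. f z - model_proj \<Theta> f z) h = 0)"
    unfolding model_proj_def by (rule someI_ex[OF model_projection_exists[OF f]])
  then show p: "model_proj \<Theta> f \<in> model_space \<Theta>"
    by blast
  show "L2_inner (model_proj \<Theta> f) h = L2_inner f h" if h: "h \<in> model_space \<Theta>"
    using * h L2_inner_diff_left[OF f model_space_L2[OF p] model_space_L2[OF h]] by simp
qed

section \<open>Truncated Toeplitz operators and their matrices\<close>

lemma truncated_toeplitz_model_proj:
  assumes "\<phi> \<in> Linf_circle"
  shows "truncated_toeplitz \<Theta> (\<lambda>f. model_proj \<Theta> (\<lambda>z. \<phi> z * f z))"
  unfolding truncated_toeplitz_def
  using assms model_proj_in_model_space[OF L2_circle_Linf_mult[OF _ model_space_L2]] by auto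

text \<open>
  The projection can be moved to the basis functions, on which it acts as the identity. Only the
  integrals of the symbol against the products of basis functions remain.
\<close>

lemma matrix_rep_truncated_toeplitz_iff:
  assumes v: "\<And>i. v i \<in> model_space \<Theta>"
  shows "(\<exists>A. truncated_toeplitz \<Theta> A \<and> matrix_rep v A = S) \<longleftrightarrow>
    (\<exists>\<phi>\<in>Linf_circle. \<forall>i j. (\<integral>z. \<phi> z * (v j z * cnj (v i z)) \<partial>circle_measure) = S $ i $ j)"
proof -
  have entry: "L2_inner g (v i) = (\<integral>z. \<phi> z * (v j z * cnj (v i z)) \<partial>circle_measure)"
    if p: "\<phi> \<in> Linf_circle" and g: "g \<in> model_space \<Theta>"
      "AE z in circle_measure. g z = model_proj \<Theta> (\<lambda>z. \<phi> z * v j z) z" for \<phi> g i j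
  proof -
    have l2: "(\<lambda>z. \<phi> z * v j z) \<in> L2_circle"
      by (rule L2_circle_Linf_mult[OF p model_space_L2[OF v]])
    have "L2_inner g (v i) = L2_inner (model_proj \<Theta> (\<lambda>z. \<phi> z * v j z)) (v i)"
      using g model_proj_in_model_space[OF l2] v
      by (intro L2_inner_cong_AE L2_circle_measurable model_space_L2) auto
    also have "\<dots> = L2_inner (\<lambda>z. \<phi> z * v j z) (v i)"
      by (rule L2_inner_model_proj[OF l2 v])
    finally show ?thesis
      by (simp add: L2_inner_def mult.assoc)
  qed
  show ?thesis
  proof
    assume "\<exists>A. truncated_toeplitz \<Theta> A \<and> matrix_rep v A = S"
    then obtain A \<phi> where p: "\<phi> \<in> Linf_circle" and S: "matrix_rep v A = S"
      and A: "\<And>f. f \<in> model_space \<Theta> \<Longrightarrow> A f \<in> model_space \<Theta> \<and>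
        (AE z in circle_measure. A f z = model_proj \<Theta> (\<lambda>z. \<phi> z * f z) z)"
      unfolding truncated_toeplitz_def by blast
    have "(\<integral>z. \<phi> z * (v j z * cnj (v i z)) \<partial>circle_measure) = S $ i $ j" for i j
      using entry[OF p, of "A (v j)" j i] A[OF v] by (simp add: S[symmetric] matrix_rep_def)
    then show "\<exists>\<phi>\<in>Linf_circle. \<forall>i j. (\<integral>z. \<phi> z * (v j z * cnj (v i z)) \<partial>circle_measure) = S $ i $ j"
      using p by blast
  next
    assume "\<exists>\<phi>\<in>Linf_circle. \<forall>i j. (\<integral>z. \<phi> z * (v j z * cnj (v i z)) \<partial>circle_measure) = S $ i $ j"
    then obtain \<phi> where p: "\<phi> \<in> Linf_circle"
      and S: "\<And>i j. (\<integral>z. \<phi> z * (v j z * cnj (v i z)) \<partial>circle_measure) = S $ i $ j"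
      by blast
    let ?A = "\<lambda>f. model_proj \<Theta> (\<lambda>z. \<phi> z * f z)"
    have "L2_inner (?A (v j)) (v i) = S $ i $ j" for i j
    proof -
      have "?A (v j) \<in> model_space \<Theta>"
        by (rule model_proj_in_model_space[OF L2_circle_Linf_mult[OF p model_space_L2[OF v]]])
      then show ?thesis
        using entry[OF p, of "?A (v j)" j i] by (simp add: S)
    qed
    then have "matrix_rep v ?A = S"
      by (simp add: matrix_rep_def vec_eq_iff)
    then show "\<exists>A. truncated_toeplitz \<Theta> A \<and> matrix_rep v A = S"
      using truncated_toeplitz_model_proj[OF p] by blast
  qed
qed

section \<open>Kernels at boundary points\<close>

lemma repro_kernel_model_space: "repro_kernel \<zeta> \<in> model_space \<Theta>"
  unfolding repro_kernel_def by (rule takenaka_sum_model_space)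

lemma disc_algebra_repro_kernel: "disc_algebra (repro_kernel \<zeta>)"
  unfolding repro_kernel_def by (rule disc_algebra_takenaka_sum)

text \<open>
  The expansion of the kernel holds everywhere on the circle, since both sides are continuous there;
  at the point \<open>\<eta>\<close> it becomes the claim.
\<close>

lemma L2_inner_repro_kernel_repro_kernel:
  assumes e: "cmod \<eta> = 1"
  shows "L2_inner (repro_kernel \<eta>) (repro_kernel \<eta>) = repro_kernel \<eta> \<eta>"
proof -
  let ?p = "\<lambda>z. repro_kernel \<eta> z - (\<Sum>j<n. L2_inner (repro_kernel \<eta>) (takenaka j) * takenaka j z)"
  have "?p \<eta> = 0"
  proof (rule AE_circle_imp_sphere[of ?p])
    show "AE z in circle_measure. ?p z = 0"
      using model_space_expansion[OF repro_kernel_model_space] by eventually_elim simp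
    show "continuous_on (sphere 0 1) ?p"
      by (intro continuous_on_diff disc_algebra_continuous_sphere disc_algebra_repro_kernel disc_algebra_takenaka_sum)
  qed (use e in auto)
  then have "repro_kernel \<eta> \<eta> = (\<Sum>j<n. takenaka j \<eta> * L2_inner (repro_kernel \<eta>) (takenaka j))"
    by (simp add: mult.commute)
  also have "\<dots> = L2_inner (repro_kernel \<eta>) (\<lambda>z. \<Sum>j<n. cnj (takenaka j \<eta>) * takenaka j z)"
    by (subst L2_inner_sum_right) (auto simp: takenaka_L2 disc_algebra_L2 disc_algebra_repro_kernel)
  finally show ?thesis
    by (simp add: repro_kernel_def[abs_def])
qed

lemma repro_kernel_diagonal: "repro_kernel \<eta> \<eta> = of_real (\<Sum>j<n. (cmod (takenaka j \<eta>))\<^sup>2)"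
  by (simp add: repro_kernel_def complex_norm_square mult.commute del: of_real_power)

lemma Theta_field_differentiable:
  assumes "cmod \<eta> \<le> 1"
  shows "\<Theta> field_differentiable at \<eta>"
proof -
  have "\<Theta> analytic_on {\<eta>}"
    unfolding \<Theta>_def blaschke_factor_def
    using one_minus_cnj_mult_nonzero[OF a assms] by (intro analytic_intros) auto
  then show ?thesis
    by (simp add: analytic_on_imp_differentiable_at)
qed

text \<open>
  Since \<open>\<Theta> \<eta>\<close> and \<open>\<eta>\<close> are unimodular, the kernel is, up to a unimodular factor, the difference
  quotient of \<open>\<Theta>\<close> at \<open>\<eta>\<close>. It is continuous on the closed disc, so its value is the derivative.
\<close>

lemma deriv_Theta:
  assumes e: "cmod \<eta> = 1"
  shows "deriv \<Theta> \<eta> = \<Theta> \<eta> * cnj \<eta> * repro_kernel \<eta> \<eta>"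
proof -
  have ee: "\<eta> * cnj \<eta> = 1" and tt: "\<Theta> \<eta> * cnj (\<Theta> \<eta>) = 1"
    using e unimodular_cnj_mult Theta_circle by auto
  have "(\<Theta> has_field_derivative deriv \<Theta> \<eta>) (at \<eta> within cball 0 1)"
    using Theta_field_differentiable[of \<eta>] e
    by (simp add: DERIV_deriv_iff_field_differentiable has_field_derivative_at_within)
  then have 1: "((\<lambda>z. (\<Theta> z - \<Theta> \<eta>) / (z - \<eta>)) \<longlongrightarrow> deriv \<Theta> \<eta>) (at \<eta> within cball 0 1)"
    by (simp add: has_field_derivative_iff)
  have "((\<lambda>z. \<Theta> \<eta> * cnj \<eta> * repro_kernel \<eta> z) \<longlongrightarrow> \<Theta> \<eta> * cnj \<eta> * repro_kernel \<eta> \<eta>) (at \<eta> within cball 0 1)"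
    using disc_algebra_repro_kernel[of \<eta>] e
    by (intro tendsto_mult tendsto_const) (auto simp: disc_algebra_def continuous_on_def)
  moreover have "eventually (\<lambda>z. \<Theta> \<eta> * cnj \<eta> * repro_kernel \<eta> z = (\<Theta> z - \<Theta> \<eta>) / (z - \<eta>)) (at \<eta> within cball 0 1)"
    unfolding eventually_at_filter
  proof (intro always_eventually allI impI)
    fix z
    assume z: "z \<noteq> \<eta>" "z \<in> cball 0 1"
    have 1: "\<eta> * (1 - cnj \<eta> * z) = \<eta> - z"
      using arg_cong[OF ee, of "\<lambda>t. t * z"] by (simp add: right_diff_distrib mult.assoc)
    have 2: "\<Theta> \<eta> * (1 - cnj (\<Theta> \<eta>) * \<Theta> z) = \<Theta> \<eta> - \<Theta> z"
      using arg_cong[OF tt, of "\<lambda>t. t * \<Theta> z"] by (simp add: right_diff_distrib mult.assoc)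
    have 3: "repro_kernel \<eta> z * (1 - cnj \<eta> * z) = 1 - cnj (\<Theta> \<eta>) * \<Theta> z"
      using z e by (intro repro_kernel_eq) auto
    have "\<Theta> \<eta> * cnj \<eta> * repro_kernel \<eta> z * (\<eta> - z) =
        (\<eta> * cnj \<eta>) * (\<Theta> \<eta> * (repro_kernel \<eta> z * (1 - cnj \<eta> * z)))"
      unfolding 1[symmetric] by (simp only: mult_ac)
    also have "\<dots> = \<Theta> \<eta> - \<Theta> z"
      unfolding 3 2 ee by simp
    finally have "\<Theta> \<eta> * cnj \<eta> * repro_kernel \<eta> z * (z - \<eta>) = \<Theta> z - \<Theta> \<eta>"
      by (metis minus_diff_eq mult_minus_right)
    then show "\<Theta> \<eta> * cnj \<eta> * repro_kernel \<eta> z = (\<Theta> z - \<Theta> \<eta>) / (z - \<eta>)"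
      using z by (simp add: eq_divide_eq)
  qed
  ultimately have "((\<lambda>z. (\<Theta> z - \<Theta> \<eta>) / (z - \<eta>)) \<longlongrightarrow> \<Theta> \<eta> * cnj \<eta> * repro_kernel \<eta> \<eta>) (at \<eta> within cball 0 1)"
    by (rule Lim_transform_eventually)
  moreover have "\<not> trivial_limit (at \<eta> within cball 0 1)"
    using e islimpt_subset[OF _ ball_subset_cball, of \<eta> 0 1]
    by (simp add: trivial_limit_within islimpt_ball)
  ultimately show ?thesis
    using tendsto_unique[OF _ 1] by simp
qed

lemma cmod_Theta:
  assumes "cmod z = 1"
  shows "cmod (\<Theta> z) = 1"
proof -
  have "cmod (\<Theta> z * cnj (\<Theta> z)) = 1"
    using Theta_circle[OF assms] by simp
  then have "(cmod (\<Theta> z))\<^sup>2 = 1"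
    by (simp add: norm_mult power2_eq_square)
  then show ?thesis
    by (simp add: power2_eq_1_iff) (use norm_ge_zero[of "\<Theta> z"] in linarith)
qed

lemma repro_kernel_eq_cmod_deriv:
  assumes "cmod \<eta> = 1"
  shows "repro_kernel \<eta> \<eta> = of_real (cmod (deriv \<Theta> \<eta>))"
proof -
  have "cmod (deriv \<Theta> \<eta>) = cmod (repro_kernel \<eta> \<eta>)"
    using assms by (simp add: deriv_Theta norm_mult cmod_Theta)
  then show ?thesis
    unfolding repro_kernel_diagonal by (simp add: sum_nonneg del: of_real_sum)
qed

lemma deriv_Theta_nonzero:
  assumes "cmod \<eta> = 1" "n > 0"
  shows "deriv \<Theta> \<eta> \<noteq> 0"
proof
  assume "deriv \<Theta> \<eta> = 0"
  then have "(\<Sum>j<n. (cmod (takenaka j \<eta>))\<^sup>2) = 0"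
    using repro_kernel_eq_cmod_deriv[OF assms(1)] unfolding repro_kernel_diagonal of_real_eq_iff by simp
  then have "takenaka 0 \<eta> = 0"
    using assms(2) by (subst (asm) sum_nonneg_eq_0_iff) auto
  moreover have "takenaka 0 \<eta> \<noteq> 0"
  proof -
    have "(cmod (a 0))\<^sup>2 < 1"
      using a[OF assms(2)] by (simp add: power_less_one_iff abs_square_less_1)
    then show ?thesis
      using one_minus_cnj_mult_nonzero[OF a[OF assms(2)], of \<eta>] assms(1) by (simp add: takenaka_def)
  qed
  ultimately show False
    by simp
qed

lemma model_kernel_eq_repro_kernel:
  assumes "cmod \<eta> = 1" "cmod z = 1" "z \<noteq> \<eta>"
  shows "model_kernel \<Theta> \<eta> z = repro_kernel \<eta> z"
proof -
  have "z - \<eta> = - \<eta> * (1 - cnj \<eta> * z)"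
    using unimodular_cnj_mult[OF assms(1)] by (simp add: algebra_simps)
  then have "1 - cnj \<eta> * z \<noteq> 0"
    using assms(3) by auto
  moreover have "repro_kernel \<eta> z * (1 - cnj \<eta> * z) = 1 - cnj (\<Theta> \<eta>) * \<Theta> z"
    using assms by (intro repro_kernel_eq) auto
  ultimately show ?thesis
    by (simp add: model_kernel_def field_simps)
qed

lemma model_kernel_AE:
  assumes "cmod \<eta> = 1"
  shows "AE z in circle_measure. model_kernel \<Theta> \<eta> z = repro_kernel \<eta> z"
  using AE_circle_not_in_finite[of "{\<eta>}", OF finite.insertI[OF finite.emptyI]] AE_space
  by eventually_elim (auto intro: model_kernel_eq_repro_kernel[OF assms])

lemma model_kernel_measurable:
  assumes "cmod \<eta> = 1"
  shows "model_kernel \<Theta> \<eta> \<in> borel_measurable circle_measure"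
proof -
  have "model_kernel \<Theta> \<eta> z = indicator (- {\<eta>}) z * repro_kernel \<eta> z" if "z \<in> space circle_measure" for z
  proof (cases "z = \<eta>")
    case True
    \<comment> \<open>Division by zero makes the kernel vanish at its own singular point.\<close>
    have "cnj \<eta> * \<eta> = 1"
      using unimodular_cnj_mult[OF assms] by (simp add: mult.commute)
    then show ?thesis
      using True by (simp add: model_kernel_def)
  next
    case False
    then show ?thesis
      using model_kernel_eq_repro_kernel[OF assms, of z] that by simp
  qed
  moreover have "(\<lambda>z. indicator (- {\<eta>}) z * repro_kernel \<eta> z) \<in> borel_measurable circle_measure"
    using L2_circle_measurable[OF disc_algebra_L2[OF disc_algebra_repro_kernel]]
    by (intro borel_measurable_times borel_measurable_circle[OF borel_measurable_indicator]) auto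
  ultimately show ?thesis
    by (subst measurable_cong)
qed

lemma L2_norm_model_kernel:
  assumes e: "cmod \<eta> = 1"
  shows "L2_norm (model_kernel \<Theta> \<eta>) = sqrt (cmod (deriv \<Theta> \<eta>))"
proof -
  have k: "repro_kernel \<eta> \<in> borel_measurable circle_measure"
    by (intro L2_circle_measurable disc_algebra_L2 disc_algebra_repro_kernel)
  have "(\<integral>z. (cmod (model_kernel \<Theta> \<eta> z))\<^sup>2 \<partial>circle_measure) = (\<integral>z. (cmod (repro_kernel \<eta> z))\<^sup>2 \<partial>circle_measure)"
  proof (rule integral_cong_AE)
    show "AE z in circle_measure. (cmod (model_kernel \<Theta> \<eta> z))\<^sup>2 = (cmod (repro_kernel \<eta> z))\<^sup>2"
      using model_kernel_AE[OF e] by eventually_elim simp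
  qed (use k model_kernel_measurable[OF e] in auto)
  moreover have "of_real (\<integral>z. (cmod (repro_kernel \<eta> z))\<^sup>2 \<partial>circle_measure) = L2_inner (repro_kernel \<eta>) (repro_kernel \<eta>)"
    unfolding L2_inner_def complex_norm_square[symmetric] by (simp del: of_real_power)
  ultimately have "complex_of_real (\<integral>z. (cmod (model_kernel \<Theta> \<eta> z))\<^sup>2 \<partial>circle_measure) =
      of_real (cmod (deriv \<Theta> \<eta>))"
    using L2_inner_repro_kernel_repro_kernel[OF e] repro_kernel_eq_cmod_deriv[OF e] by simp
  then show ?thesis
    by (simp add: L2_norm_def)
qed

section \<open>Products of Clark basis functions\<close>

text \<open>
  The members of a modified Clark basis, indexed by their points.
\<close>

definition clark :: "complex \<Rightarrow> complex \<Rightarrow> complex" where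
  "clark \<eta> z = cis ((Arg2pi (cnj \<eta>) + Arg2pi (\<Theta> \<eta>)) / 2) *
     (model_kernel \<Theta> \<eta> z / of_real (L2_norm (model_kernel \<Theta> \<eta>)))"

text \<open>
  The constants \<open>d\<^sub>i\<close> of the introduction.
\<close>

definition clark_weight :: "complex \<Rightarrow> complex" where
  "clark_weight \<eta> = 1 / (unimodular_sqrt (cnj \<eta>) * of_real (sqrt (cmod (deriv \<Theta> \<eta>))))"

text \<open>
  The common factor \<open>Z\<close> of all products of two Clark functions.
\<close>

definition clark_density :: "complex \<Rightarrow> complex \<Rightarrow> complex" where
  "clark_density w z = cnj w * cnj (\<Theta> z) * z * (\<Theta> z - w)\<^sup>2"

lemma clark_model_space:
  assumes e: "cmod \<eta> = 1"
  shows "clark \<eta> \<in> model_space \<Theta>"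
proof -
  define k where "k = cis ((Arg2pi (cnj \<eta>) + Arg2pi (\<Theta> \<eta>)) / 2) / of_real (L2_norm (model_kernel \<Theta> \<eta>))"
  have clark: "clark \<eta> = (\<lambda>z. k * model_kernel \<Theta> \<eta> z)"
    by (auto simp: clark_def k_def)
  show ?thesis
  proof (rule model_space_cong_AE)
    show "(\<lambda>z. \<Sum>j<n. (k * cnj (takenaka j \<eta>)) * takenaka j z) \<in> model_space \<Theta>"
      by (rule takenaka_sum_model_space)
    show "clark \<eta> \<in> borel_measurable circle_measure"
      unfolding clark using model_kernel_measurable[OF e] by measurable
    show "AE z in circle_measure. (\<Sum>j<n. (k * cnj (takenaka j \<eta>)) * takenaka j z) = clark \<eta> z"
      using model_kernel_AE[OF e]
      by eventually_elim (simp add: clark repro_kernel_def sum_distrib_left mult.assoc)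
  qed (rule Theta_Linf)
qed

text \<open>
  Writing \<open>u\<close> for the square root of \<open>cnj \<eta>\<close>, the numerator and the denominator of the kernel give
  a factor \<open>cnj w * \<eta>\<close>. The unimodular constant of the Clark function is \<open>u\<close> times the square root
  of \<open>w\<close>, and \<open>u * \<eta> = 1 / u\<close>. In the conjugate, \<open>cnj u = 1 / u\<close> appears at once. This is the reason
  for the normalization of the modified Clark basis.
\<close>

lemma clark_eq:
  assumes e: "cmod \<eta> = 1" and z: "cmod z = 1" "z \<noteq> \<eta>"
  shows "clark \<eta> z = cnj (unimodular_sqrt (\<Theta> \<eta>)) * clark_weight \<eta> * (\<Theta> z - \<Theta> \<eta>) / (z - \<eta>)"
    and "cnj (clark \<eta> z) = cnj (unimodular_sqrt (\<Theta> \<eta>)) * clark_weight \<eta> *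
      (cnj (\<Theta> z) * z * (\<Theta> z - \<Theta> \<eta>)) / (z - \<eta>)"
proof -
  define u s w N where "u = unimodular_sqrt (cnj \<eta>)" and "s = unimodular_sqrt (\<Theta> \<eta>)"
    and "w = \<Theta> \<eta>" and "N = complex_of_real (sqrt (cmod (deriv \<Theta> \<eta>)))"
  have uu: "u * u = cnj \<eta>" and ss: "s * s = w"
    using e cmod_Theta[OF e] by (auto simp: u_def s_def w_def unimodular_sqrt_square)
  have uc: "u * cnj u = 1" and sc: "s * cnj s = 1" and ec: "\<eta> * cnj \<eta> = 1" and zc: "z * cnj z = 1"
    and wc: "w * cnj w = 1" and tc: "\<Theta> z * cnj (\<Theta> z) = 1"
    using e z by (auto intro!: unimodular_cnj_mult simp: u_def s_def w_def cmod_Theta)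
  have nz: "\<eta> \<noteq> 0" "z \<noteq> 0" "u \<noteq> 0" "w \<noteq> 0" "s \<noteq> 0" "\<Theta> z \<noteq> 0"
    using ec zc uc wc sc tc by auto
  have ci: "cnj \<eta> = 1 / \<eta>" "cnj z = 1 / z" "cnj u = 1 / u" "cnj w = 1 / w" "cnj s = 1 / s"
    "cnj (\<Theta> z) = 1 / \<Theta> z"
    using ec zc uc wc sc tc nz by (auto simp: field_simps)
  have eu: "\<eta> = 1 / (u * u)"
    using uu ci nz by (simp add: field_simps)
  have cis: "cis ((Arg2pi (cnj \<eta>) + Arg2pi w) / 2) = u * s"
    by (simp add: u_def s_def w_def unimodular_sqrt_def cis_mult add_divide_distrib)
  have cl: "clark \<eta> z = u * s * ((1 - cnj w * \<Theta> z) / (1 - cnj \<eta> * z) / N)"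
    unfolding clark_def w_def[symmetric] cis L2_norm_model_kernel[OF e] N_def[symmetric]
    by (simp add: model_kernel_def w_def)
  have ne: "z - \<eta> \<noteq> 0"
    using z by simp
  have d1: "(1 - cnj w * \<Theta> z) / (1 - cnj \<eta> * z) = cnj w * \<eta> * (\<Theta> z - w) / (z - \<eta>)"
  proof -
    have "1 - cnj w * \<Theta> z = - cnj w * (\<Theta> z - w)" "1 - cnj \<eta> * z = - cnj \<eta> * (z - \<eta>)"
      using wc ec by (simp_all add: algebra_simps)
    then show ?thesis
      using nz by (simp add: ci)
  qed
  have d2: "(1 - w * cnj (\<Theta> z)) / (1 - \<eta> * cnj z) = cnj (\<Theta> z) * z * (\<Theta> z - w) / (z - \<eta>)"
  proof -
    have "1 - w * cnj (\<Theta> z) = cnj (\<Theta> z) * (\<Theta> z - w)" "1 - \<eta> * cnj z = cnj z * (z - \<eta>)"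
      using tc zc by (simp_all add: algebra_simps)
    then show ?thesis
      using nz by (simp add: ci)
  qed
  have wt: "clark_weight \<eta> = 1 / (u * N)"
    by (simp add: clark_weight_def u_def N_def)
  have "s * cnj w = cnj s"
    using ss nz unfolding ci by (simp add: field_simps)
  moreover have "u * \<eta> = 1 / u"
    using nz by (simp add: eu)
  moreover have "clark \<eta> z = (s * cnj w) * (u * \<eta>) * (\<Theta> z - w) / (z - \<eta>) / N"
    unfolding cl d1 by (simp add: mult_ac)
  ultimately have "clark \<eta> z = cnj s * (1 / (u * N)) * (\<Theta> z - w) / (z - \<eta>)"
    by (simp add: mult_ac)
  then show "clark \<eta> z = cnj (unimodular_sqrt (\<Theta> \<eta>)) * clark_weight \<eta> * (\<Theta> z - \<Theta> \<eta>) / (z - \<eta>)"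
    unfolding s_def w_def wt .
  have "cnj (clark \<eta> z) = cnj u * cnj s * ((1 - w * cnj (\<Theta> z)) / (1 - \<eta> * cnj z) / N)"
    unfolding cl by (simp add: N_def)
  then have "cnj (clark \<eta> z) = cnj s * (1 / (u * N)) *
      (cnj (\<Theta> z) * z * (\<Theta> z - w)) / (z - \<eta>)"
    unfolding d2 by (simp add: ci(3) mult_ac)
  then show "cnj (clark \<eta> z) = cnj (unimodular_sqrt (\<Theta> \<eta>)) * clark_weight \<eta> *
      (cnj (\<Theta> z) * z * (\<Theta> z - \<Theta> \<eta>)) / (z - \<eta>)"
    unfolding s_def w_def wt .
qed

lemma clark_product:
  assumes "cmod \<eta> = 1" "cmod \<zeta> = 1" "cmod z = 1" "z \<noteq> \<eta>" "z \<noteq> \<zeta>" "\<Theta> \<eta> = w" "\<Theta> \<zeta> = w"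
  shows "clark \<zeta> z * cnj (clark \<eta> z) =
    clark_density w z * (clark_weight \<eta> * clark_weight \<zeta> / ((z - \<eta>) * (z - \<zeta>)))"
proof -
  have "unimodular_sqrt w * unimodular_sqrt w = w"
    using assms cmod_Theta[of \<eta>] by (simp add: unimodular_sqrt_square)
  then have s: "cnj w = cnj (unimodular_sqrt w) * cnj (unimodular_sqrt w)"
    by (metis complex_cnj_mult)
  show ?thesis
    unfolding clark_eq(1)[OF assms(2,3,5)] clark_eq(2)[OF assms(1,3,4)] assms(6,7)
      clark_density_def s power2_eq_square
    by (simp add: mult_ac)
qed

lemma clark_Linf:
  assumes e: "cmod \<eta> = 1"
  shows "clark \<eta> \<in> Linf_circle"
proof -
  define k where "k = cis ((Arg2pi (cnj \<eta>) + Arg2pi (\<Theta> \<eta>)) / 2) / of_real (L2_norm (model_kernel \<Theta> \<eta>))"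
  obtain C where C: "AE z in circle_measure. cmod (repro_kernel \<eta> z) \<le> C"
    using continuous_sphere_Linf[OF disc_algebra_continuous_sphere[OF disc_algebra_repro_kernel]]
    by (auto simp: Linf_circle_def)
  have "AE z in circle_measure. cmod (clark \<eta> z) \<le> cmod k * C"
    using C model_kernel_AE[OF e]
  proof eventually_elim
    case (elim z)
    then have "clark \<eta> z = k * repro_kernel \<eta> z"
      by (simp add: clark_def k_def)
    with elim show ?case
      by (simp add: norm_mult mult_left_mono)
  qed
  then show ?thesis
    using L2_circle_measurable[OF model_space_L2[OF clark_model_space[OF e]]]
    by (auto simp: Linf_circle_def)
qed

lemma clark_product_Linf:
  assumes "cmod \<eta> = 1" "cmod \<zeta> = 1"
  shows "(\<lambda>z. clark \<zeta> z * cnj (clark \<eta> z)) \<in> Linf_circle"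
proof (rule Linf_circle_mult)
  show "(\<lambda>z. cnj (clark \<eta> z)) \<in> Linf_circle"
    using Linf_circle_sum_cnj[of "{()}" "\<lambda>_. clark \<eta>" "\<lambda>_. 1"] clark_Linf[OF assms(1)] by simp
qed (rule clark_Linf[OF assms(2)])

lemma clark_weight_nonzero:
  assumes "cmod \<eta> = 1" "n > 0"
  shows "clark_weight \<eta> \<noteq> 0"
  using deriv_Theta_nonzero[OF assms] cmod_unimodular_sqrt[of "cnj \<eta>"]
  by (auto simp: clark_weight_def simp del: cmod_unimodular_sqrt)

lemma clark_density_nonzero:
  assumes "cmod z = 1" "cmod w = 1" "\<Theta> z \<noteq> w"
  shows "clark_density w z \<noteq> 0"
  using assms cmod_Theta[OF assms(1)] by (auto simp: clark_density_def)

lemma clark_product_commute: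
  assumes "cmod \<eta> = 1" "cmod \<zeta> = 1" "\<Theta> \<eta> = \<Theta> \<zeta>"
  shows "AE z in circle_measure. clark \<zeta> z * cnj (clark \<eta> z) = clark \<eta> z * cnj (clark \<zeta> z)"
  using AE_circle_not_in_finite[OF finite_set, of "[\<eta>, \<zeta>]"] AE_space
proof eventually_elim
  case (elim z)
  then show ?case
    using assms by (simp add: clark_product mult.commute)
qed

text \<open>
  Multiplied by the difference of the two points, each product is a difference of two simple
  fractions, up to the weights and the common factor \<open>clark_density\<close>. The three differences add up
  to 0 around the triangle.
\<close>

lemma clark_three_term_AE:
  assumes e: "cmod \<eta>\<^sub>1 = 1" "cmod \<eta>\<^sub>2 = 1" "cmod \<eta>\<^sub>3 = 1"
    and w: "\<Theta> \<eta>\<^sub>1 = w" "\<Theta> \<eta>\<^sub>2 = w" "\<Theta> \<eta>\<^sub>3 = w"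
  shows "AE z in circle_measure.
    clark_weight \<eta>\<^sub>1 * (\<eta>\<^sub>3 - \<eta>\<^sub>2) * (clark \<eta>\<^sub>3 z * cnj (clark \<eta>\<^sub>2 z)) =
    clark_weight \<eta>\<^sub>2 * (\<eta>\<^sub>3 - \<eta>\<^sub>1) * (clark \<eta>\<^sub>3 z * cnj (clark \<eta>\<^sub>1 z)) +
    clark_weight \<eta>\<^sub>3 * (\<eta>\<^sub>1 - \<eta>\<^sub>2) * (clark \<eta>\<^sub>2 z * cnj (clark \<eta>\<^sub>1 z))"
  using AE_circle_not_in_finite[OF finite_set, of "[\<eta>\<^sub>1, \<eta>\<^sub>2, \<eta>\<^sub>3]"] AE_space
proof eventually_elim
  case (elim z)
  then have z: "cmod z = 1" "z \<noteq> \<eta>\<^sub>1" "z \<noteq> \<eta>\<^sub>2" "z \<noteq> \<eta>\<^sub>3"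
    by auto
  have partial: "(\<zeta> - \<eta>) / ((z - \<eta>) * (z - \<zeta>)) = 1 / (z - \<zeta>) - 1 / (z - \<eta>)"
    if "z \<noteq> \<eta>" "z \<noteq> \<zeta>" for \<eta> \<zeta>
    using that by (simp add: divide_simps)
  have prod: "(\<zeta> - \<eta>) * (clark \<zeta> z * cnj (clark \<eta> z)) =
      clark_density w z * (clark_weight \<eta> * clark_weight \<zeta>) * (1 / (z - \<zeta>) - 1 / (z - \<eta>))"
    if "cmod \<eta> = 1" "cmod \<zeta> = 1" "z \<noteq> \<eta>" "z \<noteq> \<zeta>" "\<Theta> \<eta> = w" "\<Theta> \<zeta> = w" for \<eta> \<zeta>
    unfolding partial[OF that(3,4), symmetric] clark_product[OF that(1,2) z(1) that(3-6)]
    by (simp add: mult_ac)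
  have "\<eta>\<^sub>1 - \<eta>\<^sub>2 = - (\<eta>\<^sub>2 - \<eta>\<^sub>1)"
    by simp
  then show ?case
    using prod[of \<eta>\<^sub>2 \<eta>\<^sub>3] prod[of \<eta>\<^sub>1 \<eta>\<^sub>3] prod[of \<eta>\<^sub>1 \<eta>\<^sub>2] z e w
    by (simp only: mult.assoc mult_minus_left mult_minus_right simp_thms) (simp add: algebra_simps)
qed

text \<open>
  Up to the common factor, the products are \<open>1 / (z - \<eta>\<^sub>i)\<^sup>2\<close> and \<open>1 / ((z - \<eta>\<^sub>1) * (z - \<eta>\<^sub>j))\<close>. With
  the denominators cleared, a vanishing combination is a polynomial that vanishes on the circle. Its
  values at the three points determine the coefficients of the squares. Once these are gone, a linear
  polynomial remains, and it is evaluated at \<open>\<eta>\<^sub>2\<close> and \<open>\<eta>\<^sub>3\<close>.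
\<close>

lemma clark_products_independent:
  fixes x\<^sub>1 x\<^sub>2 x\<^sub>3 y\<^sub>2 y\<^sub>3 :: complex
  assumes n: "n > 0"
    and e: "cmod \<eta>\<^sub>1 = 1" "cmod \<eta>\<^sub>2 = 1" "cmod \<eta>\<^sub>3 = 1"
    and ne: "\<eta>\<^sub>1 \<noteq> \<eta>\<^sub>2" "\<eta>\<^sub>1 \<noteq> \<eta>\<^sub>3" "\<eta>\<^sub>2 \<noteq> \<eta>\<^sub>3"
    and w: "{z \<in> sphere 0 1. \<Theta> z = w} = {\<eta>\<^sub>1, \<eta>\<^sub>2, \<eta>\<^sub>3}"
    and zero: "AE z in circle_measure.
      x\<^sub>1 * (clark \<eta>\<^sub>1 z * cnj (clark \<eta>\<^sub>1 z)) + x\<^sub>2 * (clark \<eta>\<^sub>2 z * cnj (clark \<eta>\<^sub>2 z)) +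
      x\<^sub>3 * (clark \<eta>\<^sub>3 z * cnj (clark \<eta>\<^sub>3 z)) + y\<^sub>2 * (clark \<eta>\<^sub>2 z * cnj (clark \<eta>\<^sub>1 z)) +
      y\<^sub>3 * (clark \<eta>\<^sub>3 z * cnj (clark \<eta>\<^sub>1 z)) = 0"
  shows "x\<^sub>1 = 0 \<and> x\<^sub>2 = 0 \<and> x\<^sub>3 = 0 \<and> y\<^sub>2 = 0 \<and> y\<^sub>3 = 0"
proof -
  have w': "\<Theta> \<eta>\<^sub>1 = w" "\<Theta> \<eta>\<^sub>2 = w" "\<Theta> \<eta>\<^sub>3 = w"
    using w by auto
  have w1: "cmod w = 1"
    using w' e cmod_Theta by metis
  define d\<^sub>1 d\<^sub>2 d\<^sub>3 where "d\<^sub>1 = clark_weight \<eta>\<^sub>1" and "d\<^sub>2 = clark_weight \<eta>\<^sub>2" and "d\<^sub>3 = clark_weight \<eta>\<^sub>3"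
  have d: "d\<^sub>1 \<noteq> 0" "d\<^sub>2 \<noteq> 0" "d\<^sub>3 \<noteq> 0"
    using n e by (auto simp: d\<^sub>1_def d\<^sub>2_def d\<^sub>3_def clark_weight_nonzero)
  let ?p = "\<lambda>z. x\<^sub>1 * d\<^sub>1\<^sup>2 * ((z - \<eta>\<^sub>2)\<^sup>2 * (z - \<eta>\<^sub>3)\<^sup>2) + x\<^sub>2 * d\<^sub>2\<^sup>2 * ((z - \<eta>\<^sub>1)\<^sup>2 * (z - \<eta>\<^sub>3)\<^sup>2) +
      x\<^sub>3 * d\<^sub>3\<^sup>2 * ((z - \<eta>\<^sub>1)\<^sup>2 * (z - \<eta>\<^sub>2)\<^sup>2) +
      d\<^sub>1 * (z - \<eta>\<^sub>1) * (z - \<eta>\<^sub>2) * (z - \<eta>\<^sub>3) * (y\<^sub>2 * d\<^sub>2 * (z - \<eta>\<^sub>3) + y\<^sub>3 * d\<^sub>3 * (z - \<eta>\<^sub>2))"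
  have "AE z in circle_measure. ?p z = 0"
    using zero AE_circle_not_in_finite[OF finite_set, of "[\<eta>\<^sub>1, \<eta>\<^sub>2, \<eta>\<^sub>3]"] AE_space
  proof eventually_elim
    case (elim z)
    then have z: "cmod z = 1" "z \<noteq> \<eta>\<^sub>1" "z \<noteq> \<eta>\<^sub>2" "z \<noteq> \<eta>\<^sub>3"
      by auto
    then have "\<Theta> z \<noteq> w"
      using w by auto
    then have q: "clark_density w z \<noteq> 0"
      using clark_density_nonzero z w1 by blast
    define u\<^sub>1 u\<^sub>2 u\<^sub>3 where "u\<^sub>1 = z - \<eta>\<^sub>1" and "u\<^sub>2 = z - \<eta>\<^sub>2" and "u\<^sub>3 = z - \<eta>\<^sub>3"
    have u: "u\<^sub>1 \<noteq> 0" "u\<^sub>2 \<noteq> 0" "u\<^sub>3 \<noteq> 0"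
      using z by (auto simp: u\<^sub>1_def u\<^sub>2_def u\<^sub>3_def)
    have "clark_density w z * (x\<^sub>1 * (d\<^sub>1 * d\<^sub>1 / (u\<^sub>1 * u\<^sub>1)) + x\<^sub>2 * (d\<^sub>2 * d\<^sub>2 / (u\<^sub>2 * u\<^sub>2)) +
        x\<^sub>3 * (d\<^sub>3 * d\<^sub>3 / (u\<^sub>3 * u\<^sub>3)) + y\<^sub>2 * (d\<^sub>1 * d\<^sub>2 / (u\<^sub>1 * u\<^sub>2)) + y\<^sub>3 * (d\<^sub>1 * d\<^sub>3 / (u\<^sub>1 * u\<^sub>3))) = 0"
      using elim(1) unfolding clark_product[OF e(1) e(1) z(1) z(2) z(2) w'(1) w'(1)]
        clark_product[OF e(2) e(2) z(1) z(3) z(3) w'(2) w'(2)]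
        clark_product[OF e(3) e(3) z(1) z(4) z(4) w'(3) w'(3)]
        clark_product[OF e(1) e(2) z(1) z(2) z(3) w'(1) w'(2)]
        clark_product[OF e(1) e(3) z(1) z(2) z(4) w'(1) w'(3)]
        u\<^sub>1_def[symmetric] u\<^sub>2_def[symmetric] u\<^sub>3_def[symmetric]
        d\<^sub>1_def[symmetric] d\<^sub>2_def[symmetric] d\<^sub>3_def[symmetric]
      by (simp only: distrib_left mult.left_commute)
    then have r: "x\<^sub>1 * (d\<^sub>1 * d\<^sub>1 / (u\<^sub>1 * u\<^sub>1)) + x\<^sub>2 * (d\<^sub>2 * d\<^sub>2 / (u\<^sub>2 * u\<^sub>2)) +
        x\<^sub>3 * (d\<^sub>3 * d\<^sub>3 / (u\<^sub>3 * u\<^sub>3)) + y\<^sub>2 * (d\<^sub>1 * d\<^sub>2 / (u\<^sub>1 * u\<^sub>2)) + y\<^sub>3 * (d\<^sub>1 * d\<^sub>3 / (u\<^sub>1 * u\<^sub>3)) = 0"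
      using q by simp
    have "?p z = (u\<^sub>1 * u\<^sub>2 * u\<^sub>3)\<^sup>2 * (x\<^sub>1 * (d\<^sub>1 * d\<^sub>1 / (u\<^sub>1 * u\<^sub>1)) + x\<^sub>2 * (d\<^sub>2 * d\<^sub>2 / (u\<^sub>2 * u\<^sub>2)) +
        x\<^sub>3 * (d\<^sub>3 * d\<^sub>3 / (u\<^sub>3 * u\<^sub>3)) + y\<^sub>2 * (d\<^sub>1 * d\<^sub>2 / (u\<^sub>1 * u\<^sub>2)) + y\<^sub>3 * (d\<^sub>1 * d\<^sub>3 / (u\<^sub>1 * u\<^sub>3)))"
      unfolding u\<^sub>1_def[symmetric] u\<^sub>2_def[symmetric] u\<^sub>3_def[symmetric]
      using u by (simp add: field_simps power2_eq_square)
    then show ?case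
      unfolding r by simp
  qed
  then have p: "?p z = 0" if "cmod z = 1" for z
    by (rule AE_circle_imp_sphere) (use that in \<open>auto intro!: continuous_intros\<close>)
  have x: "x\<^sub>1 = 0" "x\<^sub>2 = 0" "x\<^sub>3 = 0"
    using p[OF e(1)] p[OF e(2)] p[OF e(3)] ne d by auto
  let ?q = "\<lambda>z. y\<^sub>2 * d\<^sub>2 * (z - \<eta>\<^sub>3) + y\<^sub>3 * d\<^sub>3 * (z - \<eta>\<^sub>2)"
  have "AE z in circle_measure. ?q z = 0"
    using AE_circle_not_in_finite[OF finite_set, of "[\<eta>\<^sub>1, \<eta>\<^sub>2, \<eta>\<^sub>3]"] AE_space
  proof eventually_elim
    case (elim z)
    then show ?case
      using p[of z] d by (simp add: x)
  qed
  then have q: "?q z = 0" if "cmod z = 1" for z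
    by (rule AE_circle_imp_sphere) (use that in \<open>auto intro!: continuous_intros\<close>)
  show ?thesis
    using q[OF e(2)] q[OF e(3)] ne d x by auto
qed

end

section \<open>Symmetric matrices of order three\<close>

lemma finite_blaschke_product_locale:
  assumes "finite_blaschke_product n \<theta>"
  obtains c a where "finite_blaschke n c a" "\<theta> = finite_blaschke.\<Theta> n c a"
proof -
  obtain c a where ca: "cmod c = 1" "\<forall>i<n. cmod (a i) < 1"
      "\<theta> = (\<lambda>z. c * (\<Prod>i<n. (z - a i) / (1 - cnj (a i) * z)))"
    using assms by (auto simp: finite_blaschke_product_def)
  then interpret finite_blaschke n c a
    by unfold_locales auto
  have "\<theta> = \<Theta>"
    by (auto simp: ca \<Theta>_def blaschke_factor_def)
  then show ?thesis
    using that finite_blaschke_axioms by blast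
qed

theorem theorem3p5:
  fixes \<theta> :: "complex \<Rightarrow> complex"
    and \<eta> :: "3 \<Rightarrow> complex"
    and cb :: "3 \<Rightarrow> complex \<Rightarrow> complex"
    and s\<^sub>1 s\<^sub>2 s\<^sub>3 s\<^sub>4 s\<^sub>5 s\<^sub>6 :: complex
    and S :: "complex ^ 3 ^ 3"
  assumes "finite_blaschke_product 3 \<theta>"
    and "modified_clark_basis \<theta> \<eta> cb"
    and "S = vector [vector [s\<^sub>1, s\<^sub>4, s\<^sub>5],
                     vector [s\<^sub>4, s\<^sub>2, s\<^sub>6],
                     vector [s\<^sub>5, s\<^sub>6, s\<^sub>3]]"
  shows "(\<exists>A. truncated_toeplitz \<theta> A \<and> matrix_rep cb A = S) \<longleftrightarrow>
    s\<^sub>6 = 1 / (\<eta> 3 - \<eta> 2) *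
      (s\<^sub>4 * ((unimodular_sqrt (cnj (\<eta> 1)) * complex_of_real (sqrt (cmod (deriv \<theta> (\<eta> 1))))) /
             (unimodular_sqrt (cnj (\<eta> 3)) * complex_of_real (sqrt (cmod (deriv \<theta> (\<eta> 3)))))) *
         (\<eta> 1 - \<eta> 2) +
       s\<^sub>5 * ((unimodular_sqrt (cnj (\<eta> 1)) * complex_of_real (sqrt (cmod (deriv \<theta> (\<eta> 1))))) /
             (unimodular_sqrt (cnj (\<eta> 2)) * complex_of_real (sqrt (cmod (deriv \<theta> (\<eta> 2)))))) *
         (\<eta> 3 - \<eta> 1))"
proof -
  obtain c a where "finite_blaschke 3 c a" and \<theta>: "\<theta> = finite_blaschke.\<Theta> 3 c a"
    using finite_blaschke_product_locale[OF assms(1)] .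
  then interpret finite_blaschke 3 c a
    by simp
  obtain w where bij: "bij_betw \<eta> UNIV {\<zeta> \<in> sphere 0 1. \<Theta> \<zeta> = w}"
    and cb: "cb = (\<lambda>i z. cis ((Arg2pi (cnj (\<eta> i)) + Arg2pi w) / 2) *
      (model_kernel \<Theta> (\<eta> i) z / complex_of_real (L2_norm (model_kernel \<Theta> (\<eta> i)))))"
    using assms(2) unfolding modified_clark_basis_def \<theta> by blast
  have \<eta>: "cmod (\<eta> i) = 1" "\<Theta> (\<eta> i) = w" for i
    using bij_betw_apply[OF bij, of i] by auto
  have inj: "\<eta> i = \<eta> j \<longleftrightarrow> i = j" for i j
    using bij_betw_imp_inj_on[OF bij] by (rule inj_eq)
  have range: "{\<zeta> \<in> sphere 0 1. \<Theta> \<zeta> = w} = {\<eta> 1, \<eta> 2, \<eta> 3}"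
    using bij_betw_imp_surj_on[OF bij] unfolding UNIV_3 by auto
  have cb: "cb i = clark (\<eta> i)" for i
    by (auto simp: cb clark_def \<eta>)
  have cb_space: "cb i \<in> model_space \<Theta>" for i
    unfolding cb by (rule clark_model_space[OF \<eta>(1)])
  define e where "e \<phi> i j = (\<integral>z. \<phi> z * (cb j z * cnj (cb i z)) \<partial>circle_measure)" for \<phi> i j
  have integrable: "integrable circle_measure (\<lambda>z. \<phi> z * (cb j z * cnj (cb i z)))"
    if "\<phi> \<in> Linf_circle" for \<phi> i j
    unfolding cb
    by (intro L2_circle_mult_integrable Linf_circle_imp_L2_circle that clark_product_Linf \<eta>)
  have e_commute: "e \<phi> i j = e \<phi> j i" if "\<phi> \<in> Linf_circle" for \<phi> i j
    unfolding e_def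
  proof (rule integral_cong_AE)
    show "AE z in circle_measure. \<phi> z * (cb j z * cnj (cb i z)) = \<phi> z * (cb i z * cnj (cb j z))"
      using clark_product_commute[of "\<eta> i" "\<eta> j"] \<eta> unfolding cb by (auto elim: AE_mp)
  qed (use integrable[OF that] in \<open>auto dest: borel_measurable_integrable\<close>)
  define d where "d i = clark_weight (\<eta> i)" for i
  have d: "d i \<noteq> 0" for i
    using clark_weight_nonzero \<eta> by (simp add: d_def)
  have relation: "d 1 * (\<eta> 3 - \<eta> 2) * e \<phi> 2 3 =
      d 2 * (\<eta> 3 - \<eta> 1) * e \<phi> 1 3 + d 3 * (\<eta> 1 - \<eta> 2) * e \<phi> 1 2" if \<phi>: "\<phi> \<in> Linf_circle" for \<phi>
  proof -
    have "(\<integral>z. d 1 * (\<eta> 3 - \<eta> 2) * (\<phi> z * (cb 3 z * cnj (cb 2 z))) \<partial>circle_measure) =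
        (\<integral>z. d 2 * (\<eta> 3 - \<eta> 1) * (\<phi> z * (cb 3 z * cnj (cb 1 z))) +
            d 3 * (\<eta> 1 - \<eta> 2) * (\<phi> z * (cb 2 z * cnj (cb 1 z))) \<partial>circle_measure)"
    proof (rule integral_cong_AE)
      show "AE z in circle_measure. d 1 * (\<eta> 3 - \<eta> 2) * (\<phi> z * (cb 3 z * cnj (cb 2 z))) =
          d 2 * (\<eta> 3 - \<eta> 1) * (\<phi> z * (cb 3 z * cnj (cb 1 z))) +
          d 3 * (\<eta> 1 - \<eta> 2) * (\<phi> z * (cb 2 z * cnj (cb 1 z)))"
        using clark_three_term_AE[of "\<eta> 1" "\<eta> 2" "\<eta> 3", OF \<eta>(1) \<eta>(1) \<eta>(1) \<eta>(2) \<eta>(2) \<eta>(2)]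
      proof eventually_elim
        case (elim z)
        from arg_cong[OF this, of "\<lambda>t. \<phi> z * t"] show ?case
          by (simp only: d_def cb distrib_left mult.left_commute)
      qed
    qed (intro borel_measurable_integrable integrable_mult_right Bochner_Integration.integrable_add integrable \<phi>)+
    then show ?thesis
      using integrable[OF \<phi>] by (simp add: e_def)
  qed
  have solve: "d 1 * (\<eta> 3 - \<eta> 2) * m = d 2 * (\<eta> 3 - \<eta> 1) * s\<^sub>5 + d 3 * (\<eta> 1 - \<eta> 2) * s\<^sub>4 \<longleftrightarrow>
      m = 1 / (\<eta> 3 - \<eta> 2) * (s\<^sub>4 * (d 3 / d 1) * (\<eta> 1 - \<eta> 2) + s\<^sub>5 * (d 2 / d 1) * (\<eta> 3 - \<eta> 1))" for m
  proof -
    define D where "D = d 1 * (\<eta> 3 - \<eta> 2)"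
    have D: "D \<noteq> 0"
      using d[of 1] by (simp add: D_def inj)
    have eq: "1 / (\<eta> 3 - \<eta> 2) * (s\<^sub>4 * (d 3 / d 1) * (\<eta> 1 - \<eta> 2) + s\<^sub>5 * (d 2 / d 1) * (\<eta> 3 - \<eta> 1)) =
        (d 2 * (\<eta> 3 - \<eta> 1) * s\<^sub>5 + d 3 * (\<eta> 1 - \<eta> 2) * s\<^sub>4) / D"
      by (simp add: D_def add_divide_distrib distrib_left mult_ac)
    show ?thesis
      unfolding D_def[symmetric] eq by (simp only: nonzero_eq_divide_eq[OF D] mult.commute[of D m])
  qed
  have ratio: "d i / d 1 = (unimodular_sqrt (cnj (\<eta> 1)) * complex_of_real (sqrt (cmod (deriv \<Theta> (\<eta> 1))))) /
      (unimodular_sqrt (cnj (\<eta> i)) * complex_of_real (sqrt (cmod (deriv \<Theta> (\<eta> i)))))" for i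
    by (simp add: d_def clark_weight_def)
  have S: "S $ 1 $ 1 = s\<^sub>1" "S $ 2 $ 2 = s\<^sub>2" "S $ 3 $ 3 = s\<^sub>3" "S $ 1 $ 2 = s\<^sub>4" "S $ 2 $ 1 = s\<^sub>4"
    "S $ 1 $ 3 = s\<^sub>5" "S $ 3 $ 1 = s\<^sub>5" "S $ 2 $ 3 = s\<^sub>6" "S $ 3 $ 2 = s\<^sub>6"
    by (simp_all add: assms(3))
  have "(\<exists>A. truncated_toeplitz \<Theta> A \<and> matrix_rep cb A = S) \<longleftrightarrow>
      (\<exists>\<phi>\<in>Linf_circle. \<forall>i j. e \<phi> i j = S $ i $ j)"
    unfolding e_def by (rule matrix_rep_truncated_toeplitz_iff[OF cb_space])
  also have "\<dots> \<longleftrightarrow> d 1 * (\<eta> 3 - \<eta> 2) * s\<^sub>6 = d 2 * (\<eta> 3 - \<eta> 1) * s\<^sub>5 + d 3 * (\<eta> 1 - \<eta> 2) * s\<^sub>4"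
  proof
    assume "\<exists>\<phi>\<in>Linf_circle. \<forall>i j. e \<phi> i j = S $ i $ j"
    then show "d 1 * (\<eta> 3 - \<eta> 2) * s\<^sub>6 = d 2 * (\<eta> 3 - \<eta> 1) * s\<^sub>5 + d 3 * (\<eta> 1 - \<eta> 2) * s\<^sub>4"
      using relation S by metis
  next
    assume s: "d 1 * (\<eta> 3 - \<eta> 2) * s\<^sub>6 = d 2 * (\<eta> 3 - \<eta> 1) * s\<^sub>5 + d 3 * (\<eta> 1 - \<eta> 2) * s\<^sub>4"
    \<comment> \<open>The five entries that can be prescribed: the diagonal, and those at (1,2) and (1,3).\<close>
    define row col :: "3 + bool \<Rightarrow> 3" where
      "row = case_sum (\<lambda>i. i) (\<lambda>b. 1)" and "col = case_sum (\<lambda>i. i) (\<lambda>b. if b then 2 else 3)"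
    have indices: "UNIV = {Inl 1, Inl 2, Inl 3, Inr True, Inr False :: 3 + bool}"
    proof -
      have "k \<in> {Inl 1, Inl 2, Inl 3, Inr True, Inr False :: 3 + bool}" for k
        using exhaust_3 by (cases k) auto
      then show ?thesis
        by blast
    qed
    have "\<exists>\<phi>\<in>Linf_circle. \<forall>k. (\<integral>z. \<phi> z * (cb (col k) z * cnj (cb (row k) z)) \<partial>circle_measure)
        = S $ row k $ col k"
    proof (rule Linf_dual_exists)
      show "(\<lambda>z. cb (col k) z * cnj (cb (row k) z)) \<in> Linf_circle" for k
        unfolding cb by (intro clark_product_Linf \<eta>)
      fix x :: "3 + bool \<Rightarrow> complex" and k :: "3 + bool"
      assume "AE z in circle_measure. (\<Sum>k\<in>UNIV. x k * (cb (col k) z * cnj (cb (row k) z))) = 0"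
      then have "AE z in circle_measure.
          x (Inl 1) * (clark (\<eta> 1) z * cnj (clark (\<eta> 1) z)) + x (Inl 2) * (clark (\<eta> 2) z * cnj (clark (\<eta> 2) z)) +
          x (Inl 3) * (clark (\<eta> 3) z * cnj (clark (\<eta> 3) z)) + x (Inr True) * (clark (\<eta> 2) z * cnj (clark (\<eta> 1) z)) +
          x (Inr False) * (clark (\<eta> 3) z * cnj (clark (\<eta> 1) z)) = 0"
        unfolding indices by (simp add: row_def col_def cb add.assoc)
      from clark_products_independent[OF _ \<eta>(1) \<eta>(1) \<eta>(1) _ _ _ range this]
      have "x (Inl 1) = 0" "x (Inl 2) = 0" "x (Inl 3) = 0" "x (Inr True) = 0" "x (Inr False) = 0"
        by (auto simp: inj)
      moreover have "k \<in> {Inl 1, Inl 2, Inl 3, Inr True, Inr False}"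
        unfolding indices[symmetric] by (rule UNIV_I)
      ultimately show "x k = 0"
        by auto
    qed
    then obtain \<phi> where \<phi>: "\<phi> \<in> Linf_circle" and "\<And>k. e \<phi> (row k) (col k) = S $ row k $ col k"
      by (auto simp: e_def)
    from this(2)[of "Inl 1"] this(2)[of "Inl 2"] this(2)[of "Inl 3"]
      this(2)[of "Inr True"] this(2)[of "Inr False"]
    have e: "e \<phi> 1 1 = s\<^sub>1" "e \<phi> 2 2 = s\<^sub>2" "e \<phi> 3 3 = s\<^sub>3" "e \<phi> 1 2 = s\<^sub>4" "e \<phi> 1 3 = s\<^sub>5"
      by (simp_all add: row_def col_def S)
    have "d 1 * (\<eta> 3 - \<eta> 2) * e \<phi> 2 3 = d 1 * (\<eta> 3 - \<eta> 2) * s\<^sub>6"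
      using relation[OF \<phi>] s by (simp add: e)
    then have "e \<phi> 2 3 = s\<^sub>6"
      using d[of 1] by (simp add: inj)
    then have "\<forall>i j. e \<phi> i j = S $ i $ j"
      using e e_commute[OF \<phi>, of 2 1] e_commute[OF \<phi>, of 3 1] e_commute[OF \<phi>, of 3 2]
      by (simp add: forall_3 S)
    then show "\<exists>\<phi>\<in>Linf_circle. \<forall>i j. e \<phi> i j = S $ i $ j"
      using \<phi> by blast
  qed
  finally show ?thesis
    unfolding solve ratio \<theta> .
qed

end
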